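(* Let $0<T<\infty$, $x_0\in\mathbb{R}$, $\mu,\sigma:[0,T]\times\mathbb{R}\to\mathbb{R}$, and let $B$ be a Brownian motion with $B(0)=0$ on a complete probability space $(\Omega,\mathcal{F},\mathbb{P})$. Consider the stochastic differential equation $$dX(t)=\mu(t,X(t))\,dt+\sigma(t,X(t))\,dB(t),\qquad X(0)=x_0,\qquad 0\le t\le T. \qquad (\ast)$$ Let $\phi(t,u)$, $(t,u)\in[0,T]\times\mathbb{R}$, be the unique solution of the ordinary differential equation (with parameter $t\in[0,T]$) $$\phi'_u(t,u)=\sigma(t,\phi(t,u)),\qquad \phi(t,0)=x_0,$$ and let $D$ denote the range of $\phi$ over $[0,T]\times\mathbb{R}$. Assume: (1) $\mu$ and $\sigma$ are continuous and $\sigma>0$ on $[0,T]\times D$; (2) $\phi\in C^{1,2}([0,T]\times\mathbb{R})$. Let $X(t)=\phi(t,B(t))$ $(0\le t\le T)$ be the weak solution of the SDE $(\ast)$ obtained by the construction described in the context, and take the approximations $X_m(t):=\phi(t,B_m(t))$ $(0\le t\le T,\ m=0,1,2,\dots)$, where $B_m$ are the Skorohod embedded random walks of $B$. Then, as $m\to\infty$, $$\sup_{0\le t\le T}|X_m(t)-X(t)|=O\left(m^{\frac34}2^{-\frac m2}\right)\qquad\text{a.s.}$$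
   Context: $C^{1,2}([0,T]\times\mathbb{R})$ denotes the functions of $(t,u)$ that are once continuously differentiable in $t$ and twice continuously differentiable in $u$. Skorohod embedded random walks: for every $m\ge0$ let $s_m(0)=0$ and $s_m(k+1)=\inf\{s>s_m(k):|B(s)-B(s_m(k))|=2^{-m}\}$ for $k\ge0$. Set $B_m(k2^{-2m}):=B(s_m(k))$ for $k\ge0$, and extend $B_m$ to all real $t\ge0$ by pathwise linear interpolation. Construction of the weak solution: put $X(t):=\phi(t,B(t))$. By Itô's formula, $dX(t)=\nu(t,B(t))\,dt+\sigma(t,X(t))\,dB(t)$, $X(0)=x_0$, where $\nu(t,u):=\phi'_t(t,u)+\frac12\phi''_{uu}(t,u)$. Let $\psi(t):=\{\nu(t,B(t))-\mu(t,X(t))\}/\sigma(t,X(t))$ and $\Lambda(t):=\exp\{-\int_0^t\psi(s)\,dB(s)-\frac12\int_0^t\psi^2(s)\,ds\}$. In this construction $\Lambda(t)$, $0\le t\le T$, is assumed to be a $\mathbb{P}$-martingale; then, with $d\mathbb{Q}/d\mathbb{P}=\Lambda(T)$, Girsanov's theorem gives that $W(t):=B(t)+\int_0^t\psi(s)\,ds$ is a $\mathbb{Q}$-Brownian motion and $X$ satisfies $dX(t)=\mu(t,X(t))\,dt+\sigma(t,X(t))\,dW(t)$, $X(0)=x_0$, on $[0,T]$. That is, $X$ is a weak solution of $(\ast)$. *)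

theory Defs
  imports "HOL-Probability.Probability" "HOL-Library.Landau_Symbols"
begin

section \<open>Functions on the strip \<open>[0,T] \<times> \<real>\<close>\<close>

text \<open>
  Functions on \<open>[0,T] \<times> \<real>\<close> are total functions \<open>real \<Rightarrow> real \<Rightarrow> real\<close> of which only the
  values at times in \<open>{0..T}\<close> matter; accordingly the time derivative is taken within
  \<open>{0..T}\<close>, i.e. it is one-sided at the two end points.
\<close>

definition dt :: "real \<Rightarrow> (real \<Rightarrow> real \<Rightarrow> real) \<Rightarrow> real \<Rightarrow> real \<Rightarrow> real" where
  "dt T f t u = vector_derivative (\<lambda>s. f s u) (at t within {0..T})"

definition du :: "(real \<Rightarrow> real \<Rightarrow> real) \<Rightarrow> real \<Rightarrow> real \<Rightarrow> real" where
  "du f t u = deriv (f t) u"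

definition C12_on :: "real \<Rightarrow> (real \<Rightarrow> real \<Rightarrow> real) \<Rightarrow> bool" where
  "C12_on T f \<longleftrightarrow>
     (\<forall>t\<in>{0..T}. \<forall>u.
        (\<lambda>s. f s u) differentiable (at t within {0..T}) \<and>
        f t differentiable (at u) \<and>
        du f t differentiable (at u)) \<and>
     (\<forall>g\<in>{f, dt T f, du f, du (du f)}. continuous_on ({0..T} \<times> UNIV) (\<lambda>(t, u). g t u))"

definition unique_flow ::
  "real \<Rightarrow> real \<Rightarrow> (real \<Rightarrow> real \<Rightarrow> real) \<Rightarrow> (real \<Rightarrow> real \<Rightarrow> real) \<Rightarrow> bool" where
  "unique_flow T x0 \<sigma> \<phi> \<longleftrightarrow>
     (\<forall>t\<in>{0..T}.
        \<phi> t 0 = x0 \<and>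
        (\<forall>u. (\<phi> t has_real_derivative \<sigma> t (\<phi> t u)) (at u)) \<and>
        (\<forall>f. f 0 = x0 \<and> (\<forall>u. (f has_real_derivative \<sigma> t (f u)) (at u)) \<longrightarrow> f = \<phi> t))"


section \<open>Brownian motion\<close>

text \<open>The process is indexed by \<open>real\<close>; only times \<open>t \<ge> 0\<close> are constrained.\<close>

locale brownian_motion = prob_space M
  for M :: "'a measure" and B :: "real \<Rightarrow> 'a \<Rightarrow> real" +
  assumes measurable_BM: "\<And>t. 0 \<le> t \<Longrightarrow> B t \<in> borel_measurable M"
    and start_BM: "AE \<omega> in M. B 0 \<omega> = 0"
    and continuous_BM: "AE \<omega> in M. continuous_on {0..} (\<lambda>t. B t \<omega>)"
    and normal_increments_BM:
      "\<And>s t. 0 \<le> s \<Longrightarrow> s < t \<Longrightarrow>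
         distributed M lborel (\<lambda>\<omega>. B t \<omega> - B s \<omega>) (normal_density 0 (sqrt (t - s)))"
    and indep_increments_BM:
      "\<And>(n::nat) (p::nat \<Rightarrow> real). 0 \<le> p 0 \<Longrightarrow> (\<And>i. i < n \<Longrightarrow> p i < p (Suc i)) \<Longrightarrow>
         indep_vars (\<lambda>_. borel) (\<lambda>i \<omega>. B (p (Suc i)) \<omega> - B (p i) \<omega>) {..<n}"

definition augmented_filtration ::
  "'a measure \<Rightarrow> (real \<Rightarrow> 'a \<Rightarrow> real) \<Rightarrow> real \<Rightarrow> 'a measure" where
  "augmented_filtration M B t =
     sigma (space M)
       ({B s -` A \<inter> space M | s A. 0 \<le> s \<and> s \<le> t \<and> A \<in> sets borel} \<union> null_sets M)"

definition martingale_upto ::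
  "'a measure \<Rightarrow> (real \<Rightarrow> 'a measure) \<Rightarrow> real \<Rightarrow> (real \<Rightarrow> 'a \<Rightarrow> real) \<Rightarrow> bool" where
  "martingale_upto M F T L \<longleftrightarrow>
     (\<forall>t\<in>{0..T}. L t \<in> borel_measurable (F t) \<and> integrable M (L t)) \<and>
     (\<forall>s t. 0 \<le> s \<and> s \<le> t \<and> t \<le> T \<longrightarrow> (AE \<omega> in M. real_cond_exp M (F s) (L t) \<omega> = L s \<omega>))"


section \<open>Ito integral\<close>

definition converges_in_probability ::
  "'a measure \<Rightarrow> (nat \<Rightarrow> 'a \<Rightarrow> real) \<Rightarrow> ('a \<Rightarrow> real) \<Rightarrow> bool" where
  "converges_in_probability M Y Z \<longleftrightarrow>
     (\<forall>n. Y n \<in> borel_measurable M) \<and> Z \<in> borel_measurable M \<and>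
     (\<forall>\<epsilon>>0. (\<lambda>n. measure M {\<omega> \<in> space M. \<epsilon> < \<bar>Y n \<omega> - Z \<omega>\<bar>}) \<longlonglongrightarrow> 0)"

text \<open>
  A simple integrand on \<open>[0,T]\<close> is given by a partition \<open>0 = p 0 < \<dots> < p n = T\<close> and
  bounded weights \<open>\<xi> i\<close>, each known at time \<open>p i\<close>; its value is \<open>\<xi> i\<close> on
  \<open>(p i, p (i + 1)]\<close>.
\<close>

definition simple_integrand ::
  "(real \<Rightarrow> 'a measure) \<Rightarrow> real \<Rightarrow> nat \<Rightarrow> (nat \<Rightarrow> real) \<Rightarrow> (nat \<Rightarrow> 'a \<Rightarrow> real) \<Rightarrow> bool" where
  "simple_integrand F T n p \<xi> \<longleftrightarrow>
     p 0 = 0 \<and> p n = T \<and> (\<forall>i<n. p i < p (Suc i)) \<and>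
     (\<forall>i<n. \<xi> i \<in> borel_measurable (F (p i)) \<and> (\<exists>C. \<forall>\<omega>\<in>space (F (p i)). \<bar>\<xi> i \<omega>\<bar> \<le> C))"

definition simple_value ::
  "nat \<Rightarrow> (nat \<Rightarrow> real) \<Rightarrow> (nat \<Rightarrow> 'a \<Rightarrow> real) \<Rightarrow> real \<Rightarrow> 'a \<Rightarrow> real" where
  "simple_value n p \<xi> t \<omega> = (\<Sum>i<n. \<xi> i \<omega> * indicator {p i<..p (Suc i)} t)"

definition simple_integral ::
  "(real \<Rightarrow> 'a \<Rightarrow> real) \<Rightarrow> nat \<Rightarrow> (nat \<Rightarrow> real) \<Rightarrow> (nat \<Rightarrow> 'a \<Rightarrow> real) \<Rightarrow> real \<Rightarrow> 'a \<Rightarrow> real" where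
  "simple_integral B n p \<xi> t \<omega> =
     (\<Sum>i<n. \<xi> i \<omega> * (B (min t (p (Suc i))) \<omega> - B (min t (p i)) \<omega>))"

text \<open>
  The process \<open>I\<close> is a continuous version of \<open>t \<mapsto> \<integral>\<^sub>0\<^sup>t \<psi> dB\<close> on \<open>[0,T]\<close>, in the usual sense for
  integrands with almost surely square integrable paths: simple integrands approximate \<open>\<psi>\<close> in
  \<open>L\<^sup>2[0,T]\<close> in probability, and their elementary integrals converge to \<open>I\<close> in probability.
  This determines \<open>I\<close> on \<open>[0,T]\<close> up to indistinguishability.
\<close>

definition ito_integral ::
  "'a measure \<Rightarrow> (real \<Rightarrow> 'a measure) \<Rightarrow> (real \<Rightarrow> 'a \<Rightarrow> real) \<Rightarrow> real \<Rightarrow>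
   (real \<Rightarrow> 'a \<Rightarrow> real) \<Rightarrow> (real \<Rightarrow> 'a \<Rightarrow> real) \<Rightarrow> bool" where
  "ito_integral M F B T \<psi> I \<longleftrightarrow>
     (\<forall>t\<in>{0..T}. I t \<in> borel_measurable (F t)) \<and>
     (AE \<omega> in M. continuous_on {0..T} (\<lambda>t. I t \<omega>)) \<and>
     (AE \<omega> in M. set_borel_measurable lborel {0..T} (\<lambda>t. \<psi> t \<omega>) \<and>
                  set_integrable lborel {0..T} (\<lambda>t. (\<psi> t \<omega>)\<^sup>2)) \<and>
     (\<exists>n p \<xi>.
        (\<forall>k. simple_integrand F T (n k) (p k) (\<xi> k)) \<and>
        converges_in_probability M
          (\<lambda>k \<omega>. LINT t:{0..T}|lborel. (simple_value (n k) (p k) (\<xi> k) t \<omega> - \<psi> t \<omega>)\<^sup>2)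
          (\<lambda>_. 0) \<and>
        (\<forall>t\<in>{0..T}. converges_in_probability M
          (\<lambda>k. simple_integral B (n k) (p k) (\<xi> k) t) (I t)))"


section \<open>Skorohod embedded random walks\<close>

text \<open>
  The infimum is taken over the reals. Its value for the empty set is irrelevant: almost surely a
  Brownian path leaves every bounded interval, so the set is nonempty for all \<open>m\<close> and \<open>k\<close>.
\<close>

primrec skorohod_time :: "(real \<Rightarrow> 'a \<Rightarrow> real) \<Rightarrow> nat \<Rightarrow> nat \<Rightarrow> 'a \<Rightarrow> real" where
  "skorohod_time B m 0 \<omega> = 0"
| "skorohod_time B m (Suc k) \<omega> =
     Inf {s. s > skorohod_time B m k \<omega> \<and>
             \<bar>B s \<omega> - B (skorohod_time B m k \<omega>) \<omega>\<bar> = 1 / 2 ^ m}"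

text \<open>
  For \<open>t = (k + \<theta>) 2\<^sup>-\<^sup>2\<^sup>m\<close> with \<open>k\<close> a natural number and \<open>0 \<le> \<theta> < 1\<close>, the value is
  \<open>(1 - \<theta>) B(s\<^sub>m(k)) + \<theta> B(s\<^sub>m(k + 1))\<close>.
\<close>

definition skorohod_walk :: "(real \<Rightarrow> 'a \<Rightarrow> real) \<Rightarrow> nat \<Rightarrow> real \<Rightarrow> 'a \<Rightarrow> real" where
  "skorohod_walk B m t \<omega> =
     (let k = nat \<lfloor>t * 2 ^ (2 * m)\<rfloor>; \<theta> = frac (t * 2 ^ (2 * m))
      in (1 - \<theta>) * B (skorohod_time B m k \<omega>) \<omega> + \<theta> * B (skorohod_time B m (Suc k) \<omega>) \<omega>)"

end

theory Submission
  imports Defs "HOL-Real_Asymp.Real_Asymp"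
begin

text \<open>
  Since \<open>\<phi>\<close> is Lipschitz on compact sets, it suffices to bound \<open>\<bar>B\<^sub>m(t) - B(t)\<bar>\<close>, and by Levy's modulus of
  continuity this amounts to \<open>\<bar>s\<^sub>m(k) - k 4\<^sup>-\<^sup>m\<bar> = O(m\<^sup>1\<^sup>/\<^sup>2 2\<^sup>-\<^sup>m)\<close> for \<open>k \<le> T 4\<^sup>m\<close>.
  With \<open>a = 2\<^sup>-\<^sup>m\<close>, let \<open>r(t)\<close> be the value of \<open>B\<close> at the last embedding time before \<open>t\<close> and \<open>K(t)\<close> the
  number of embedding times up to \<open>t\<close>. Then \<open>K(t) a\<^sup>2 + (B(t) - r(t))\<^sup>2 - t = 2 \<integral>\<^sub>0\<^sup>t (B - r) dB\<close>, whose
  integrand is bounded by \<open>a\<close>, so that its exponential moments of order \<open>\<kappa>\<close> are at most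
  \<open>exp (2 \<kappa>\<^sup>2 a\<^sup>2 t)\<close>; with \<open>\<kappa> = m\<^sup>1\<^sup>/\<^sup>2 2\<^sup>m\<close> a union bound over dyadic \<open>t\<close> applies. No stochastic integral
  is needed: the identity is discretised on a grid, where \<open>r\<close> is a function of finitely many
  independent increments, and Fatou's lemma carries the exponential bound to the limit.
\<close>

section \<open>Exponential moments\<close>

lemma ln_one_minus_ge:
  fixes y :: real
  assumes "\<bar>y\<bar> \<le> 1/2"
  shows "- y - 2 * y\<^sup>2 \<le> ln (1 - y)"
  using abs_ln_one_plus_x_minus_x_bound[of "-y"] assms by auto

text \<open>Completing the square turns the integrand into a constant \<open>A\<close> times a
  normal density of variance \<open>\<delta> / q\<close>, so the integral equals \<open>A\<close>.
  Apart from the contribution of \<open>c\<close>, the exponent is of second order in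
  \<open>\<kappa> * \<delta>\<close>, hence a product over t / \<open>\<delta>\<close> steps stays
  bounded as the mesh is refined.\<close>

lemma nn_integral_normal_density_exp_quadratic:
  fixes c \<delta> \<kappa> :: real
  assumes \<delta>: "0 < \<delta>" and \<kappa>: "\<bar>\<kappa>\<bar> * \<delta> \<le> 1/4"
  shows "(\<integral>\<^sup>+z. ennreal (normal_density 0 (sqrt \<delta>) z) * ennreal (exp (c * z + \<kappa> * (z\<^sup>2 - \<delta>))) \<partial>lborel)
         \<le> ennreal (exp ((4 * \<kappa>\<^sup>2 * \<delta> + c\<^sup>2) * \<delta>))"
proof -
  define q where "q = 1 - 2 * \<kappa> * \<delta>"
  have absl: "\<bar>\<kappa> * \<delta>\<bar> \<le> 1/4" using \<kappa> \<delta> by (simp add: abs_mult)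
  have q: "1/2 \<le> q" using absl unfolding q_def by linarith
  define A where "A = exp (- \<kappa> * \<delta> + c\<^sup>2 * \<delta> / (2 * q)) / sqrt q"
  have A0: "0 \<le> A" using q by (simp add: A_def)
  have expo: "- z\<^sup>2 / (2 * \<delta>) + (c * z + \<kappa> * (z\<^sup>2 - \<delta>)) =
      - (z - c * \<delta> / q)\<^sup>2 / (2 * (\<delta> / q)) + (- \<kappa> * \<delta> + c\<^sup>2 * \<delta> / (2 * q))" for z
  proof -
    have "- (z - c * \<delta> / q)\<^sup>2 / (2 * (\<delta> / q)) = - q * z\<^sup>2 / (2 * \<delta>) + c * z - c\<^sup>2 * \<delta> / (2 * q)"
      using q \<delta> by (simp add: field_simps power2_eq_square)
    moreover have "- z\<^sup>2 / (2 * \<delta>) + \<kappa> * z\<^sup>2 = - q * z\<^sup>2 / (2 * \<delta>)"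
      using \<delta> by (simp add: field_simps q_def)
    ultimately show ?thesis by (simp add: algebra_simps)
  qed
  have eq: "normal_density 0 (sqrt \<delta>) z * exp (c * z + \<kappa> * (z\<^sup>2 - \<delta>))
            = A * normal_density (c * \<delta> / q) (sqrt (\<delta> / q)) z" for z
  proof -
    have "normal_density 0 (sqrt \<delta>) z * exp (c * z + \<kappa> * (z\<^sup>2 - \<delta>))
        = exp (- z\<^sup>2 / (2 * \<delta>) + (c * z + \<kappa> * (z\<^sup>2 - \<delta>))) / sqrt (2 * pi * \<delta>)"
      using \<delta> by (simp add: normal_density_def mult_exp_exp)
    also have "\<dots> = exp (- (z - c * \<delta> / q)\<^sup>2 / (2 * (\<delta> / q))) * exp (- \<kappa> * \<delta> + c\<^sup>2 * \<delta> / (2 * q))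
                     / (sqrt (2 * pi * (\<delta> / q)) * sqrt q)"
      unfolding expo exp_add using q by (simp add: real_sqrt_divide real_sqrt_mult)
    also have "\<dots> = A * normal_density (c * \<delta> / q) (sqrt (\<delta> / q)) z"
      using q \<delta> by (simp add: normal_density_def A_def mult.commute)
    finally show ?thesis .
  qed
  interpret N: prob_space "density lborel (normal_density (c * \<delta> / q) (sqrt (\<delta> / q)))"
    using q \<delta> by (intro prob_space_normal_density) simp
  have one: "(\<integral>\<^sup>+z. ennreal (normal_density (c * \<delta> / q) (sqrt (\<delta> / q)) z) \<partial>lborel) = 1"
    using N.emeasure_space_1 by (simp add: emeasure_density)
  have "(\<integral>\<^sup>+z. ennreal (normal_density 0 (sqrt \<delta>) z) * ennreal (exp (c * z + \<kappa> * (z\<^sup>2 - \<delta>))) \<partial>lborel)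
      = (\<integral>\<^sup>+z. ennreal A * ennreal (normal_density (c * \<delta> / q) (sqrt (\<delta> / q)) z) \<partial>lborel)"
    using A0 by (simp add: ennreal_mult[symmetric] eq)
  also have "\<dots> = ennreal A"
    using one by (simp add: nn_integral_cmult)
  \<comment> \<open>Centering z^2 at its mean \<open>\<delta>\<close> makes the first-order parts of
    \<open>- \<kappa> * \<delta>\<close> and \<open>- ln q / 2\<close> cancel; the smallness of
    \<open>\<kappa> * \<delta>\<close> keeps \<open>q\<close> at least 1/2, which controls the
    rest.\<close>
  also have "A \<le> exp ((4 * \<kappa>\<^sup>2 * \<delta> + c\<^sup>2) * \<delta>)"
  proof -
    have "- (2 * \<kappa> * \<delta>) - 2 * (2 * \<kappa> * \<delta>)\<^sup>2 \<le> ln q"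
      unfolding q_def by (rule ln_one_minus_ge) (use absl in linarith)
    then have l: "- \<kappa> * \<delta> - ln q / 2 \<le> 4 * \<kappa>\<^sup>2 * \<delta> * \<delta>"
      by (simp add: power2_eq_square algebra_simps)
    have "c\<^sup>2 * \<delta> * 1 \<le> c\<^sup>2 * \<delta> * (2 * q)" using q \<delta> by (intro mult_left_mono) auto
    then have m: "c\<^sup>2 * \<delta> / (2 * q) \<le> c\<^sup>2 * \<delta>"
      using q by (subst pos_divide_le_eq) auto
    have sq: "sqrt q = exp (ln q / 2)"
      using q by (simp add: ln_sqrt[symmetric])
    have "A = exp (- \<kappa> * \<delta> + c\<^sup>2 * \<delta> / (2 * q) - ln q / 2)"
      unfolding A_def sq by (simp add: exp_diff)
    then show ?thesis using l m by (simp add: algebra_simps)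
  qed
  finally show ?thesis using A0 by (simp add: ennreal_leI)
qed

text \<open>This takes the place of successive conditioning. The last increment is independent of
  the block before it, so Fubini integrates it out with its coefficient frozen, at the cost of one
  factor \<open>C\<close>; induction removes the increments one by one. Predictability is
  \<open>c_restrict\<close>: the coefficient of increment \<open>j\<close> sees only earlier
  increments.\<close>

lemma (in prob_space) nn_integral_exp_predictable_sum_le:
  fixes Z :: "nat \<Rightarrow> 'a \<Rightarrow> real" and c :: "nat \<Rightarrow> (nat \<Rightarrow> real) \<Rightarrow> real" and f :: "real \<Rightarrow> real"
  assumes ind: "indep_vars (\<lambda>_. borel) Z {..<n}"
    and meas_c: "\<And>j. c j \<in> borel_measurable (PiM {..<j} (\<lambda>_. borel))"
    and c_restrict: "\<And>j z. c j (restrict z {..<j}) = c j z"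
    and f[measurable]: "f \<in> borel_measurable borel"
    and step: "\<And>j z. j < n \<Longrightarrow>
        (\<integral>\<^sup>+x. ennreal (exp (c j z * x + f x)) \<partial>distr M borel (Z j)) \<le> ennreal C"
    and C: "0 \<le> C"
  shows "(\<integral>\<^sup>+\<omega>. ennreal (exp (\<Sum>j<n. c j (\<lambda>i. Z i \<omega>) * Z j \<omega> + f (Z j \<omega>))) \<partial>M) \<le> ennreal (C ^ n)"
proof -
  have rv: "Z j \<in> borel_measurable M" if "j < n" for j
    using ind that by (auto simp: indep_vars_def)
  have "(\<integral>\<^sup>+\<omega>. ennreal (exp (\<Sum>j<k. c j (\<lambda>i. Z i \<omega>) * Z j \<omega> + f (Z j \<omega>))) \<partial>M) \<le> ennreal (C ^ k)"
    if "k \<le> n" for k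
    using that
  proof (induction k)
    case 0
    then show ?case by (simp add: emeasure_space_1)
  next
    case (Suc k)
    let ?P = "PiM {..<k} (\<lambda>_. borel :: real measure)"
    define U where "U = (\<lambda>\<omega>. restrict (\<lambda>i. Z i \<omega>) {..<k})"
    let ?Q = "PiM {k} (\<lambda>_. borel :: real measure)"
    define V where "V = (\<lambda>\<omega>. restrict (\<lambda>i. Z i \<omega>) {k})"
    have iv: "indep_var ?P U ?Q V"
      unfolding U_def V_def using Suc.prems by (intro indep_var_restrict[OF ind]) auto
    have U[measurable]: "U \<in> measurable M ?P" and V[measurable]: "V \<in> measurable M ?Q"
      using iv by (auto dest: indep_var_rv1 indep_var_rv2)
    have Zk[measurable]: "Z k \<in> borel_measurable M" using rv Suc.prems by simp
    have joint: "distr M (?P \<Otimes>\<^sub>M ?Q) (\<lambda>\<omega>. (U \<omega>, V \<omega>)) = distr M ?P U \<Otimes>\<^sub>M distr M ?Q V"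
      using iv by (simp add: indep_var_distribution_eq)
    have Vk: "V \<omega> k = Z k \<omega>" for \<omega> by (simp add: V_def)
    have Qk[measurable]: "(\<lambda>x. x k) \<in> borel_measurable ?Q" by simp
    interpret DV: prob_space "distr M ?Q V" by (rule prob_space_distr) simp
    interpret DU: prob_space "distr M ?P U" by (rule prob_space_distr) simp
    have cm: "c j \<in> borel_measurable ?P" if "j \<le> k" for j
    proof -
      have "(\<lambda>x. restrict x {..<j}) \<in> measurable ?P (PiM {..<j} (\<lambda>_. borel))"
        using that by (intro measurable_restrict_subset) auto
      from measurable_compose[OF this meas_c[of j]] show ?thesis by (simp add: c_restrict)
    qed
    define E where "E = (\<lambda>z::nat\<Rightarrow>real. \<Sum>j<k. c j z * z j + f (z j))"
    have Em[measurable]: "E \<in> borel_measurable ?P"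
      unfolding E_def using cm by (intro borel_measurable_sum borel_measurable_add borel_measurable_times
          measurable_compose[OF _ f] measurable_component_singleton) auto
    have ck[measurable]: "c k \<in> borel_measurable ?P" using cm by simp
    have cU: "c j (U \<omega>) = c j (\<lambda>i. Z i \<omega>)" if "j \<le> k" for j \<omega>
    proof -
      have "c j (U \<omega>) = c j (restrict (U \<omega>) {..<j})" by (simp add: c_restrict)
      also have "restrict (U \<omega>) {..<j} = restrict (\<lambda>i. Z i \<omega>) {..<j}"
        using that by (auto simp: U_def restrict_def)
      finally show ?thesis by (simp only: c_restrict)
    qed
    have EU: "E (U \<omega>) = (\<Sum>j<k. c j (\<lambda>i. Z i \<omega>) * Z j \<omega> + f (Z j \<omega>))" for \<omega>
      unfolding E_def by (intro sum.cong) (auto simp: cU, simp_all add: U_def)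
    have "(\<integral>\<^sup>+\<omega>. ennreal (exp (\<Sum>j<Suc k. c j (\<lambda>i. Z i \<omega>) * Z j \<omega> + f (Z j \<omega>))) \<partial>M)
        = (\<integral>\<^sup>+\<omega>. ennreal (exp (E (U \<omega>))) * ennreal (exp (c k (U \<omega>) * Z k \<omega> + f (Z k \<omega>))) \<partial>M)"
      by (simp add: EU cU exp_add ennreal_mult mult.assoc)
    also have "\<dots> = (\<integral>\<^sup>+p. ennreal (exp (E (fst p))) * ennreal (exp (c k (fst p) * snd p k + f (snd p k)))
                       \<partial>distr M (?P \<Otimes>\<^sub>M ?Q) (\<lambda>\<omega>. (U \<omega>, V \<omega>)))"
      by (subst nn_integral_distr) (simp_all add: Vk)
    also have "\<dots> = (\<integral>\<^sup>+z. \<integral>\<^sup>+y. ennreal (exp (E z)) * ennreal (exp (c k z * y k + f (y k)))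
                       \<partial>distr M ?Q V \<partial>distr M ?P U)"
      unfolding joint by (subst DV.nn_integral_fst[symmetric]) simp_all
    also have "\<dots> = (\<integral>\<^sup>+z. ennreal (exp (E z)) * (\<integral>\<^sup>+y. ennreal (exp (c k z * y k + f (y k)))
                       \<partial>distr M ?Q V) \<partial>distr M ?P U)"
      by (intro nn_integral_cong nn_integral_cmult) simp
    also have "\<dots> = (\<integral>\<^sup>+z. ennreal (exp (E z)) * (\<integral>\<^sup>+x. ennreal (exp (c k z * x + f x))
                       \<partial>distr M borel (Z k)) \<partial>distr M ?P U)"
      by (simp add: nn_integral_distr Vk)
    also have "\<dots> \<le> (\<integral>\<^sup>+z. ennreal (exp (E z)) * ennreal C \<partial>distr M ?P U)"
      using Suc.prems by (intro nn_integral_mono mult_left_mono step) auto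
    also have "\<dots> = (\<integral>\<^sup>+\<omega>. ennreal (exp (E (U \<omega>))) \<partial>M) * ennreal C"
      by (simp add: nn_integral_multc nn_integral_distr)
    also have "\<dots> \<le> ennreal (C ^ k) * ennreal C"
      using Suc unfolding EU by (intro mult_right_mono) auto
    also have "\<dots> = ennreal (C ^ Suc k)"
      using C by (simp add: ennreal_mult[symmetric] mult.commute)
    finally show ?case .
  qed
  then show ?thesis by simp
qed

section \<open>Discretised exit times\<close>

definition clamp_abs :: "real \<Rightarrow> real \<Rightarrow> real" where
  "clamp_abs a x = max (- a) (min a x)"

lemma clamp_abs_le: "0 \<le> a \<Longrightarrow> \<bar>clamp_abs a x\<bar> \<le> a"
  by (auto simp: clamp_abs_def)

lemma clamp_abs_eq: "\<bar>x\<bar> \<le> a \<Longrightarrow> clamp_abs a x = x"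
  by (auto simp: clamp_abs_def)

lemma measurable_clamp_abs[measurable]: "clamp_abs a \<in> borel_measurable borel"
  unfolding clamp_abs_def by measurable

text \<open>The sequence \<open>x\<close> consists of the increments of a path along the grid. References move by exactly
  \<open>\<plusminus> a\<close>, so that they agree with the values of the path at the true exit times. The clamping in
  \<open>grid_gap\<close> provides the deterministic bound needed for exponential moments; on a fine enough grid it
  is inactive.\<close>

primrec grid_ref :: "real \<Rightarrow> real \<Rightarrow> (nat \<Rightarrow> real) \<Rightarrow> nat \<Rightarrow> real" where
  "grid_ref a \<epsilon> x 0 = 0"
| "grid_ref a \<epsilon> x (Suc i) =
     (let d = (\<Sum>l<Suc i. x l) - grid_ref a \<epsilon> x i
      in grid_ref a \<epsilon> x i + (if a - \<epsilon> \<le> \<bar>d\<bar> then a * sgn d else 0))"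

definition grid_gap :: "real \<Rightarrow> real \<Rightarrow> nat \<Rightarrow> (nat \<Rightarrow> real) \<Rightarrow> real" where
  "grid_gap a \<epsilon> i x = clamp_abs a ((\<Sum>l<i. x l) - grid_ref a \<epsilon> x i)"

text \<open>A discrete version of 2 int (B - r) dB. While the clamp is inactive and the reference
  stays put, each summand is exactly the increase of the squared distance to the reference minus
  \<open>\<delta>\<close>; the term \<open>(x i)\<^sup>2 - \<delta>\<close> makes this an identity
  for every path.\<close>

definition grid_sum :: "real \<Rightarrow> real \<Rightarrow> real \<Rightarrow> nat \<Rightarrow> (nat \<Rightarrow> real) \<Rightarrow> real" where
  "grid_sum a \<epsilon> \<delta> n x = (\<Sum>i<n. 2 * grid_gap a \<epsilon> i x * x i + ((x i)\<^sup>2 - \<delta>))"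

lemma grid_ref_cong:
  "(\<And>l. l < i \<Longrightarrow> x l = y l) \<Longrightarrow> grid_ref a \<epsilon> x i = grid_ref a \<epsilon> y i"
proof (induction i)
  case (Suc i)
  have "grid_ref a \<epsilon> x i = grid_ref a \<epsilon> y i" using Suc by simp
  moreover have "(\<Sum>l<Suc i. x l) = (\<Sum>l<Suc i. y l)" using Suc.prems by (intro sum.cong) auto
  ultimately show ?case by (simp only: grid_ref.simps)
qed simp

lemma grid_gap_restrict: "grid_gap a \<epsilon> i (restrict x {..<i}) = grid_gap a \<epsilon> i x"
proof -
  have "grid_ref a \<epsilon> (restrict x {..<i}) i = grid_ref a \<epsilon> x i"
    by (rule grid_ref_cong) simp
  then show ?thesis by (simp add: grid_gap_def)
qed

lemma measurable_grid_ref: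
  "i \<le> j \<Longrightarrow> (\<lambda>x. grid_ref a \<epsilon> x i) \<in> borel_measurable (PiM {..<j} (\<lambda>_. borel :: real measure))"
proof (induction i)
  case (Suc i)
  have [measurable]: "(\<lambda>x. grid_ref a \<epsilon> x i) \<in> borel_measurable (PiM {..<j} (\<lambda>_. borel))"
    using Suc by simp
  have [measurable]: "(\<lambda>x. \<Sum>l<Suc i. x l) \<in> borel_measurable (PiM {..<j} (\<lambda>_. borel :: real measure))"
    using Suc.prems by (intro borel_measurable_sum measurable_component_singleton) auto
  show ?case unfolding grid_ref.simps Let_def by measurable
qed simp

lemma measurable_grid_gap:
  "grid_gap a \<epsilon> i \<in> borel_measurable (PiM {..<i} (\<lambda>_. borel :: real measure))"
proof -
  have [measurable]: "(\<lambda>x. grid_ref a \<epsilon> x i) \<in> borel_measurable (PiM {..<i} (\<lambda>_. borel))"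
    by (rule measurable_grid_ref) simp
  have [measurable]: "(\<lambda>x. \<Sum>l<i. x l) \<in> borel_measurable (PiM {..<i} (\<lambda>_. borel :: real measure))"
    by (intro borel_measurable_sum measurable_component_singleton) auto
  show ?thesis unfolding grid_gap_def by measurable
qed

text \<open>The embedding times of one fixed path, characterised by inequalities instead of infima,
  so that the approximation on the grid is purely deterministic. Strict confinement before
  \<open>s (Suc k)\<close> makes it the first exit.\<close>

definition exit_times :: "real \<Rightarrow> (real \<Rightarrow> real) \<Rightarrow> (nat \<Rightarrow> real) \<Rightarrow> bool" where
  "exit_times a b s \<longleftrightarrow> s 0 = 0 \<and>
     (\<forall>k. s k < s (Suc k) \<and> \<bar>b (s (Suc k)) - b (s k)\<bar> = a \<and>
          (\<forall>u. s k \<le> u \<longrightarrow> u < s (Suc k) \<longrightarrow> \<bar>b u - b (s k)\<bar> < a))"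

lemma uniform_modulus:
  fixes b :: "real \<Rightarrow> real"
  assumes "continuous_on {0..} b" "0 < \<epsilon>"
  obtains \<delta> where "0 < \<delta>" "\<And>u v. \<lbrakk>0 \<le> u; u \<le> S; 0 \<le> v; v \<le> S; \<bar>u - v\<bar> \<le> \<delta>\<rbrakk> \<Longrightarrow> \<bar>b u - b v\<bar> \<le> \<epsilon>"
proof -
  have "uniformly_continuous_on {0..S} b"
    by (intro compact_uniformly_continuous continuous_on_subset[OF assms(1)]) auto
  then obtain d where d: "d > 0" "\<And>u v. \<lbrakk>u \<in> {0..S}; v \<in> {0..S}; dist v u < d\<rbrakk> \<Longrightarrow> dist (b v) (b u) < \<epsilon>"
    unfolding uniformly_continuous_on_def using assms(2) by metis
  show ?thesis
  proof (rule that[of "d/2"])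
    fix u v assume "0 \<le> u" "u \<le> S" "0 \<le> v" "v \<le> S" "\<bar>u - v\<bar> \<le> d/2"
    then show "\<bar>b u - b v\<bar> \<le> \<epsilon>"
      using d(1) d(2)[of v u] by (force simp: dist_real_def)
  qed (use d in simp)
qed

lemma exit_times_mono:
  assumes "exit_times a b s"
  shows "strict_mono s" "0 \<le> s k"
proof -
  show sm: "strict_mono s" using assms by (auto simp: exit_times_def strict_mono_Suc_iff)
  then have "mono s" by (rule strict_mono_mono)
  then have "s 0 \<le> s k" by (rule monoD) simp
  then show "0 \<le> s k" using assms by (simp add: exit_times_def)
qed

text \<open>Between consecutive exit times the path moves by \<open>a\<close>, so uniform continuity
  on \<open>{0..t}\<close> keeps those that lie there at least \<open>\<eta>\<close> apart. Only
  finitely many fit, and the least index beyond \<open>t\<close> gives the bracket.\<close>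

lemma exit_times_bracket:
  assumes b: "continuous_on {0..} b" and a: "0 < a" and s: "exit_times a b s" and t: "0 \<le> t"
  obtains K where "s K \<le> t" "t < s (Suc K)"
proof -
  obtain \<eta> where \<eta>: "0 < \<eta>" "\<And>u v. \<lbrakk>0 \<le> u; u \<le> t; 0 \<le> v; v \<le> t; \<bar>u - v\<bar> \<le> \<eta>\<rbrakk> \<Longrightarrow> \<bar>b u - b v\<bar> \<le> a/2"
    using uniform_modulus[OF b, of "a/2" t] a by auto
  have "\<exists>k. t < s k"
  proof (rule ccontr)
    assume "\<nexists>k. t < s k"
    then have le: "s k \<le> t" for k by (simp add: not_less)
    have "real k * \<eta> \<le> s k" for k
    proof (induction k)
      case 0 then show ?case using exit_times_mono(2)[OF s] by simp
    next
      case (Suc k)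
      have "\<eta> < s (Suc k) - s k"
      proof (rule ccontr)
        assume "\<not> \<eta> < s (Suc k) - s k"
        then have "\<bar>b (s (Suc k)) - b (s k)\<bar> \<le> a/2"
          using le exit_times_mono[OF s] by (intro \<eta>(2)) (auto simp: strict_mono_Suc_iff abs_of_pos)
        then show False using s a by (auto simp: exit_times_def)
      qed
      then show ?case using Suc by (simp add: algebra_simps)
    qed
    moreover obtain k where "t < real k * \<eta>" using \<eta>(1) reals_Archimedean3 by blast
    ultimately show False using le[of k] by (meson not_less order_trans)
  qed
  define j where "j = (LEAST k. t < s k)"
  have j: "t < s j" unfolding j_def using \<open>\<exists>k. t < s k\<close> by (rule LeastI_ex)
  have "j \<noteq> 0" using j s t by (intro notI) (simp add: exit_times_def)
  then obtain K where K: "j = Suc K" by (cases j) auto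
  have "\<not> t < s K" using not_less_Least[of K "\<lambda>k. t < s k"] K j_def by simp
  then show ?thesis using that[of K] j K by simp
qed

text \<open>The discretised walk may detect an exit too early, but never by more than \<open>\<eta>\<close>, and never too
  late: the tolerance \<open>\<epsilon>\<close> dominates the oscillation of \<open>b\<close> between neighbouring grid points.\<close>

lemma grid_sum_approximates:
  fixes b :: "real \<Rightarrow> real"
  assumes b: "continuous_on {0..} b" and b0: "b 0 = 0" and a: "0 < a"
    and s: "exit_times a b s" and t: "0 < t" and K: "s K \<le> t" "t < s (Suc K)"
  shows "\<exists>\<epsilon>0>0. \<forall>\<epsilon>. 0 < \<epsilon> \<and> \<epsilon> < \<epsilon>0 \<longrightarrow> (\<forall>\<^sub>F n in sequentially.
      \<bar>real K * a\<^sup>2 - t\<bar> \<le> \<bar>grid_sum a \<epsilon> (t / real n) n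
          (\<lambda>i. b (real (Suc i) * (t / real n)) - b (real i * (t / real n)))\<bar> + 3 * a\<^sup>2)"
proof -
  \<comment> \<open>The horizon reaches one exit interval beyond the one containing
    \<open>t\<close>, because the exit at \<open>s (Suc K)\<close> may be detected before
    \<open>t\<close>.\<close>
  define S where "S = s (Suc (Suc K))"
  \<comment> \<open>Each detected exit will cost an error of at most
    \<open>2 * a * \<theta>\<close>; there are at most K + 1 of them, and this choice keeps the
    total within \<open>a\<^sup>2 / 2\<close>.\<close>
  define \<theta> where "\<theta> = a / (4 * (real K + 2))"
  have \<theta>: "0 < \<theta>" "\<theta> \<le> a/8" using a by (auto simp: \<theta>_def field_simps)
  have s0: "s 0 = 0" and jump: "\<bar>b (s (Suc k)) - b (s k)\<bar> = a"
    and inside: "\<lbrakk>s k \<le> u; u < s (Suc k)\<rbrakk> \<Longrightarrow> \<bar>b u - b (s k)\<bar> < a" for k u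
    using s by (auto simp: exit_times_def)
  have smono: "strict_mono s" and spos: "0 \<le> s k" for k
    using exit_times_mono[OF s] by auto
  have sle: "s k \<le> S" if "k \<le> Suc (Suc K)" for k
    using smono that by (simp add: S_def strict_mono_less_eq)
  obtain \<eta> where \<eta>: "0 < \<eta>" and osc:
      "\<And>u v. \<lbrakk>0 \<le> u; u \<le> S; 0 \<le> v; v \<le> S; \<bar>u - v\<bar> \<le> \<eta>\<rbrakk> \<Longrightarrow> \<bar>b u - b v\<bar> \<le> \<theta>"
    using uniform_modulus[OF b \<theta>(1), of S] by auto
  have gap: "s k + \<eta> < s (Suc k)" if "k \<le> Suc K" for k
  proof (rule ccontr)
    assume "\<not> ?thesis"
    moreover have "s k < s (Suc k)" using smono by (simp add: strict_mono_Suc_iff)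
    ultimately have "\<bar>b (s (Suc k)) - b (s k)\<bar> \<le> \<theta>"
      using that by (intro osc spos sle) auto
    then show False using jump[of k] \<theta> a by simp
  qed
  \<comment> \<open>Until \<open>\<eta>\<close> before its exit the path keeps a positive distance
    from the exit level, by compactness. The range of \<open>u\<close> starts \<open>\<eta>\<close>
    before \<open>s k\<close> because the reference may already have moved to \<open>b (s k)\<close>
    by then.\<close>
  have ex: "\<exists>e>0. \<forall>u. 0 \<le> u \<and> s k - \<eta> \<le> u \<and> u \<le> s (Suc k) - \<eta> \<longrightarrow> \<bar>b u - b (s k)\<bar> < a - e"
    if "k \<le> Suc K" for k
  proof -
    have "\<exists>x\<in>{s k..s (Suc k) - \<eta>}. \<forall>y\<in>{s k..s (Suc k) - \<eta>}. \<bar>b y - b (s k)\<bar> \<le> \<bar>b x - b (s k)\<bar>"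
      using gap[OF that] spos[of k]
      by (intro continuous_attains_sup) (auto intro!: continuous_intros continuous_on_subset[OF b])
    then obtain x where x: "s k \<le> x" "x \<le> s (Suc k) - \<eta>"
      "\<And>y. \<lbrakk>s k \<le> y; y \<le> s (Suc k) - \<eta>\<rbrakk> \<Longrightarrow> \<bar>b y - b (s k)\<bar> \<le> \<bar>b x - b (s k)\<bar>" by auto
    have xa: "\<bar>b x - b (s k)\<bar> < a" using x \<eta> by (intro inside) auto
    define e where "e = min (a/2) ((a - \<bar>b x - b (s k)\<bar>) / 2)"
    have e: "0 < e" "e \<le> a/2" "\<bar>b x - b (s k)\<bar> < a - e" using xa a by (auto simp: e_def min_def field_simps)
    have "\<bar>b u - b (s k)\<bar> < a - e" if u: "0 \<le> u" "s k - \<eta> \<le> u" "u \<le> s (Suc k) - \<eta>" for u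
    proof (cases "s k \<le> u")
      case True then show ?thesis using x(3)[of u] u e by simp
    next
      case False
      then have "\<bar>b u - b (s k)\<bar> \<le> \<theta>"
        using u sle[of k] spos[of k] \<open>k \<le> Suc K\<close> by (intro osc) auto
      then show ?thesis using e \<theta> a by linarith
    qed
    then show ?thesis using e(1) by blast
  qed
  then obtain e where e: "\<And>k. k \<le> Suc K \<Longrightarrow> 0 < e k"
     "\<And>k u. \<lbrakk>k \<le> Suc K; 0 \<le> u; s k - \<eta> \<le> u; u \<le> s (Suc k) - \<eta>\<rbrakk> \<Longrightarrow> \<bar>b u - b (s k)\<bar> < a - e k"
    by metis
  define \<epsilon>0 where "\<epsilon>0 = min a (Min (e ` {..Suc K}))"
  have \<epsilon>0: "0 < \<epsilon>0" using e(1) a by (auto simp: \<epsilon>0_def)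
  have \<epsilon>0_le: "\<epsilon>0 \<le> e k" if "k \<le> Suc K" for k
    unfolding \<epsilon>0_def using that by (intro min.coboundedI2 Min_le) auto
  show ?thesis
  proof (intro exI[of _ \<epsilon>0] conjI \<epsilon>0 allI impI)
    fix \<epsilon> assume "0 < \<epsilon> \<and> \<epsilon> < \<epsilon>0"
    then have \<epsilon>: "0 < \<epsilon>" "\<epsilon> < \<epsilon>0" by auto
    have far: "\<bar>b u - b (s k)\<bar> < a - \<epsilon>"
      if "k \<le> Suc K" "0 \<le> u" "s k - \<eta> \<le> u" "u \<le> s (Suc k) - \<eta>" for k u
      using e(2)[OF that] \<epsilon>0_le[OF that(1)] \<epsilon> by linarith
    obtain \<delta>1 where \<delta>1: "0 < \<delta>1" and fine:
        "\<And>u v. \<lbrakk>0 \<le> u; u \<le> S; 0 \<le> v; v \<le> S; \<bar>u - v\<bar> \<le> \<delta>1\<rbrakk> \<Longrightarrow> \<bar>b u - b v\<bar> \<le> \<epsilon>"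
      using uniform_modulus[OF b \<epsilon>(1), of S] by auto
    have "(\<lambda>n. t / real n) \<longlonglongrightarrow> 0" by (rule lim_const_over_n)
    \<comment> \<open>A mesh below \<open>\<eta>\<close> is shorter than every exit interval
      involved; below \<open>\<delta>1\<close> it makes the path oscillate by at most
      \<open>\<epsilon>\<close> over a step, so that no exit is missed.\<close>
    then have "\<forall>\<^sub>F n in sequentially. t / real n < min \<eta> \<delta>1"
      by (rule order_tendstoD) (use \<eta> \<delta>1 in simp)
    then show "\<forall>\<^sub>F n in sequentially. \<bar>real K * a\<^sup>2 - t\<bar> \<le> \<bar>grid_sum a \<epsilon> (t / real n) n
          (\<lambda>i. b (real (Suc i) * (t / real n)) - b (real i * (t / real n)))\<bar> + 3 * a\<^sup>2"
      using eventually_gt_at_top[of 0]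
    proof eventually_elim
      case (elim n)
      define \<delta> where "\<delta> = t / real n"
      define g where "g = (\<lambda>i. real i * \<delta>)"
      have \<delta>: "0 < \<delta>" "\<delta> \<le> \<eta>" "\<delta> \<le> \<delta>1" using elim t by (auto simp: \<delta>_def)
      have gn: "g n = t" using elim by (simp add: g_def \<delta>_def)
      have g0: "0 \<le> g i" for i using \<delta> by (simp add: g_def)
      have gle: "g i \<le> t" if "i \<le> n" for i
        using that \<delta> unfolding gn[symmetric] by (simp add: g_def)
      have gSuc: "g (Suc i) = g i + \<delta>" for i by (simp add: g_def algebra_simps)
      define x where "x = (\<lambda>i. b (g (Suc i)) - b (g i))"
      have sumx: "(\<Sum>l<i. x l) = b (g i)" for i
        using sum_lessThan_telescope[of "\<lambda>i. b (g i)" i] by (simp add: x_def g_def b0)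
      define r where "r = grid_ref a \<epsilon> x"
      define N where "N = (\<lambda>i. grid_sum a \<epsilon> \<delta> i x)"
      \<comment> \<open>Invariant: \<open>k\<close> exits have been detected, the reference is the
        path at the true exit time \<open>s k\<close>, and the balance of squares and time holds up
        to one error \<open>2 * a * \<theta>\<close> per exit. The condition on
        \<open>g (Suc i)\<close>, not on \<open>g i\<close>, ensures that the next decision is taken
        no later than the next exit.\<close>
      have step: "\<exists>k\<le>Suc K. r i = b (s k) \<and> s k - \<eta> < g i \<and> g (Suc i) \<le> s (Suc k) \<and> \<bar>b (g i) - r i\<bar> \<le> a
            \<and> \<bar>N i - ((b (g i) - r i)\<^sup>2 + real k * a\<^sup>2 - g i)\<bar> \<le> real k * (2 * a * \<theta>)"
        if "i \<le> n" for i
        using that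
      proof (induction i)
        case 0
        have "g (Suc 0) \<le> s (Suc 0)" using \<delta> gap[of 0] s0 by (simp add: g_def)
        then show ?case
          using \<eta> a by (intro exI[of _ 0]) (simp add: r_def s0 b0 g_def N_def grid_sum_def)
      next
        case (Suc i)
        then obtain k where k: "k \<le> Suc K" "r i = b (s k)" "s k - \<eta> < g i" "g (Suc i) \<le> s (Suc k)"
            "\<bar>b (g i) - r i\<bar> \<le> a"
            "\<bar>N i - ((b (g i) - r i)\<^sup>2 + real k * a\<^sup>2 - g i)\<bar> \<le> real k * (2 * a * \<theta>)"
          by auto
        define d where "d = b (g (Suc i)) - r i"
        have rS: "r (Suc i) = r i + (if a - \<epsilon> \<le> \<bar>d\<bar> then a * sgn d else 0)"
          unfolding r_def grid_ref.simps Let_def sumx d_def ..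
        have "N (Suc i) = N i + (2 * clamp_abs a (b (g i) - r i) * x i + ((x i)\<^sup>2 - \<delta>))"
          unfolding N_def grid_sum_def grid_gap_def sum.lessThan_Suc sumx r_def by simp
        also have "clamp_abs a (b (g i) - r i) = b (g i) - r i" using k(5) by (rule clamp_abs_eq)
        finally have NS: "N (Suc i) = N i + (d\<^sup>2 - (b (g i) - r i)\<^sup>2 - \<delta>)"
          by (simp add: x_def d_def power2_eq_square algebra_simps)
        have gS: "g (Suc i) \<le> t" "g (Suc i) \<le> S" using gle[OF Suc.prems] K sle[of "Suc K"] by auto
        show ?case
        proof (cases "a - \<epsilon> \<le> \<bar>d\<bar>")
          case True
          have late: "s (Suc k) - \<eta> < g (Suc i)"
          proof (rule ccontr)
            assume "\<not> ?thesis"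
            then have "\<bar>b (g (Suc i)) - b (s k)\<bar> < a - \<epsilon>"
              using k(1,3) g0 \<delta> gSuc[of i] by (intro far) auto
            then show False using True by (simp add: d_def k(2))
          qed
          \<comment> \<open>An exit detected with \<open>k = Suc K\<close> would come after
            \<open>s (Suc K)\<close>, hence after \<open>t\<close>, where the grid ends.\<close>
          have kK: "k \<le> K"
          proof (rule ccontr)
            assume "\<not> k \<le> K"
            then have "k = Suc K" using k(1) by simp
            then show False using late gap[of "Suc K"] gS K by simp
          qed
          \<comment> \<open>The true jump \<open>f\<close> and the detection error \<open>h\<close>
            add up to \<open>d\<close>. As \<open>h\<close> is smaller than \<open>a\<close> in
            absolute value, \<open>d\<close> has the sign of \<open>f\<close>, so the reference
            lands exactly on \<open>b (s (Suc k))\<close>; and \<open>d\<^sup>2 - h\<^sup>2\<close>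
            differs from \<open>a\<^sup>2\<close> by just \<open>2 * f * h\<close>.\<close>
          define f where "f = b (s (Suc k)) - b (s k)"
          define h where "h = b (g (Suc i)) - b (s (Suc k))"
          have h: "\<bar>h\<bar> \<le> \<theta>" unfolding h_def using late k(4) kK by (intro osc g0 gS spos sle) auto
          have fa: "\<bar>f\<bar> = a" using jump by (simp add: f_def)
          have dfh: "d = f + h" by (simp add: d_def f_def h_def k(2))
          have "a * sgn d = f" using fa h \<theta> a dfh by (auto simp: abs_if sgn_if split: if_splits)
          then have r': "r (Suc i) = b (s (Suc k))" using True rS by (simp add: f_def k(2))
          have "\<bar>2 * f * h\<bar> \<le> 2 * a * \<theta>" using h fa a by (auto simp: abs_mult)
          moreover have "N (Suc i) - ((b (g (Suc i)) - r (Suc i))\<^sup>2 + real (Suc k) * a\<^sup>2 - g (Suc i))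
              = (N i - ((b (g i) - r i)\<^sup>2 + real k * a\<^sup>2 - g i)) + 2 * f * h"
          proof -
            have "f\<^sup>2 = a\<^sup>2" using fa by (metis power2_abs)
            moreover have "b (g (Suc i)) - r (Suc i) = h" by (simp add: h_def r')
            ultimately show ?thesis
              unfolding NS dfh by (simp add: gSuc power2_eq_square algebra_simps)
          qed
          ultimately have "\<bar>N (Suc i) - ((b (g (Suc i)) - r (Suc i))\<^sup>2 + real (Suc k) * a\<^sup>2 - g (Suc i))\<bar>
              \<le> real (Suc k) * (2 * a * \<theta>)"
            using k(6) by (simp add: algebra_simps)
          moreover have "g (Suc (Suc i)) \<le> s (Suc (Suc k))"
            using gSuc[of "Suc i"] k(4) \<delta> gap[of "Suc k"] kK by simp
          moreover have "\<bar>b (g (Suc i)) - r (Suc i)\<bar> \<le> a" using h \<theta> a by (simp add: r' h_def)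
          ultimately show ?thesis using kK r' late by (intro exI[of _ "Suc k"]) simp
        next
          case False
          then have r': "r (Suc i) = r i" using rS by simp
          \<comment> \<open>If the exit fell before the next grid point, the path would already be
            within \<open>\<epsilon>\<close> of its exit value here, and the test would have
            succeeded.\<close>
          have "g (Suc (Suc i)) \<le> s (Suc k)"
          proof (rule ccontr)
            assume "\<not> ?thesis"
            then have "\<bar>b (g (Suc i)) - b (s (Suc k))\<bar> \<le> \<epsilon>"
              using k(1,4) \<delta> gSuc[of "Suc i"] by (intro fine g0 gS spos sle) auto
            then show False using jump[of k] False by (simp add: d_def k(2))
          qed
          moreover have "\<bar>N (Suc i) - ((b (g (Suc i)) - r (Suc i))\<^sup>2 + real k * a\<^sup>2 - g (Suc i))\<bar>
              \<le> real k * (2 * a * \<theta>)"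
            using k(6) unfolding NS r' gSuc d_def by (simp add: algebra_simps)
          moreover have "\<bar>b (g (Suc i)) - r i\<bar> \<le> a" using False \<epsilon> by (simp add: d_def)
          moreover have "s k - \<eta> < g (Suc i)" using k(3) gSuc[of i] \<delta> by simp
          ultimately show ?thesis using k(1,2) r' by (intro exI[of _ k]) simp
        qed
      qed
      from step[of n] obtain k where k: "k \<le> Suc K" "t + \<delta> \<le> s (Suc k)" "\<bar>b t - r n\<bar> \<le> a"
          "\<bar>N n - ((b t - r n)\<^sup>2 + real k * a\<^sup>2 - t)\<bar> \<le> real k * (2 * a * \<theta>)"
        by (auto simp: gn gSuc)
      have "s K < s (Suc k)" using k(2) K \<delta> by simp
      then have kK: "K \<le> k" using smono by (simp add: strict_mono_less)
      \<comment> \<open>The constant 3 covers the squared gap, the possible difference of one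
        between \<open>k\<close> and \<open>K\<close>, and the accumulated error
        \<open>a\<^sup>2 / 2\<close>.\<close>
      have "(b t - r n)\<^sup>2 \<le> a\<^sup>2" using k(3) a by (simp add: abs_le_square_iff[symmetric])
      moreover have "real k * (2 * a * \<theta>) \<le> (real K + 2) * (2 * a * \<theta>)"
        using k(1) a \<theta> by (intro mult_right_mono) auto
      moreover have "(real K + 2) * (2 * a * \<theta>) = a\<^sup>2 / 2"
        by (simp add: \<theta>_def power2_eq_square field_simps)
      moreover have "real K * a\<^sup>2 \<le> real k * a\<^sup>2" "real k * a\<^sup>2 \<le> real (Suc K) * a\<^sup>2"
        using k(1) kK by (auto intro!: mult_right_mono simp del: of_nat_Suc)
      moreover have "real (Suc K) * a\<^sup>2 = real K * a\<^sup>2 + a\<^sup>2" by (simp add: algebra_simps)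
      moreover have "0 \<le> (b t - r n)\<^sup>2" "0 \<le> a\<^sup>2" by simp_all
      ultimately have "\<bar>real K * a\<^sup>2 - t\<bar> \<le> \<bar>N n\<bar> + 3 * a\<^sup>2"
        using k(4) by linarith
      then show ?case by (simp add: N_def x_def g_def \<delta>_def)
    qed
  qed
qed

section \<open>Skorohod times\<close>

text \<open>Continuity makes the set under the infimum closed, and a path unbounded along the
  integers must reach it, so the infimum is attained. By the intermediate value theorem the path
  stays strictly within distance \<open>a\<close> before the first hit.\<close>

lemma exit_times_skorohod_time:
  fixes B :: "real \<Rightarrow> 'a \<Rightarrow> real"
  assumes b: "continuous_on {0..} (\<lambda>t. B t \<omega>)"
    and unbounded: "\<And>R. \<exists>n::nat. R < \<bar>B (real n) \<omega>\<bar>"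
  shows "exit_times (1 / 2 ^ m) (\<lambda>t. B t \<omega>) (\<lambda>k. skorohod_time B m k \<omega>)"
proof -
  define a :: real where "a = 1 / 2 ^ m"
  have a: "0 < a" by (simp add: a_def)
  have *: "v < w \<and> \<bar>B w \<omega> - B v \<omega>\<bar> = a \<and> (\<forall>u. v \<le> u \<longrightarrow> u < w \<longrightarrow> \<bar>B u \<omega> - B v \<omega>\<bar> < a)"
    if v: "0 \<le> v" and w: "w = Inf {s. s > v \<and> \<bar>B s \<omega> - B v \<omega>\<bar> = a}" for v w
  proof -
    have cont: "continuous_on {v..} (\<lambda>u. \<bar>B u \<omega> - B v \<omega>\<bar>)"
      using v by (intro continuous_intros continuous_on_subset[OF b]) auto
    have cross: "\<exists>y. v \<le> y \<and> y \<le> u \<and> \<bar>B y \<omega> - B v \<omega>\<bar> = a" if "v \<le> u" "a \<le> \<bar>B u \<omega> - B v \<omega>\<bar>" for u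
      using that a by (intro IVT' continuous_on_subset[OF cont]) auto
    have "bounded ((\<lambda>t. B t \<omega>) ` {0..v})"
      by (intro compact_imp_bounded compact_continuous_image continuous_on_subset[OF b]) auto
    then obtain R where "\<forall>x\<in>(\<lambda>t. B t \<omega>) ` {0..v}. \<bar>x\<bar> \<le> R" unfolding bounded_real by blast
    then have R: "\<And>u. \<lbrakk>0 \<le> u; u \<le> v\<rbrakk> \<Longrightarrow> \<bar>B u \<omega>\<bar> \<le> R" by auto
    obtain n :: nat where n: "R + a < \<bar>B (real n) \<omega>\<bar>" using unbounded by blast
    have "v \<le> real n" using R[of "real n"] n a by (intro leI notI) simp
    moreover have "a \<le> \<bar>B (real n) \<omega> - B v \<omega>\<bar>" using R[of v] v n by simp
    ultimately obtain y0 where y0: "v \<le> y0" "\<bar>B y0 \<omega> - B v \<omega>\<bar> = a" using cross by blast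
    \<comment> \<open>The half-line may be taken closed, since at \<open>v\<close> the distance is 0
      and not \<open>a\<close>; this makes the set closed.\<close>
    define H where "H = {u \<in> {v..}. \<bar>B u \<omega> - B v \<omega>\<bar> \<in> {a}}"
    have H_eq: "H = {s. s > v \<and> \<bar>B s \<omega> - B v \<omega>\<bar> = a}"
      using a by (auto simp: H_def order_le_less)
    have "H = {v..} \<inter> (\<lambda>u. \<bar>B u \<omega> - B v \<omega>\<bar>) -` {a}" by (auto simp: H_def)
    then have "closed H" using continuous_closed_preimage[OF cont] by simp
    moreover have "H \<noteq> {}" "bdd_below H" using y0 by (auto simp: H_def intro!: bdd_belowI[of _ v])
    ultimately have "w \<in> H" unfolding w H_eq[symmetric] by (intro closed_contains_Inf)
    moreover have "\<bar>B u \<omega> - B v \<omega>\<bar> < a" if u: "v \<le> u" "u < w" for u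
    proof (rule ccontr)
      assume "\<not> ?thesis"
      then obtain y where y: "v \<le> y" "y \<le> u" "\<bar>B y \<omega> - B v \<omega>\<bar> = a" using cross[of u] u by auto
      then have "w \<le> y" unfolding w H_eq[symmetric] using \<open>bdd_below H\<close>
        by (intro cInf_lower) (auto simp: H_def)
      then show False using y u by simp
    qed
    ultimately show ?thesis by (auto simp: H_eq)
  qed
  have nonneg: "0 \<le> skorohod_time B m k \<omega>" for k
  proof (induction k)
    case (Suc k)
    then show ?case using *[OF Suc refl] by (simp add: a_def)
  qed simp
  show ?thesis unfolding exit_times_def
    using *[OF nonneg refl] by (simp add: a_def)
qed

section \<open>Unboundedness of Brownian paths\<close>

context brownian_motion
begin

text \<open>The normal density is at most \<open>1 / sqrt t\<close>, and the interval has length at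
  most \<open>2 * \<bar>R\<bar>\<close>. The decay in \<open>t\<close> is what the unboundedness of
  paths rests on.\<close>

lemma prob_abs_BM_le:
  assumes "1 \<le> t"
  shows "measure M {\<omega> \<in> space M. \<bar>B t \<omega> - B 0 \<omega>\<bar> \<le> R} \<le> 2 * \<bar>R\<bar> / sqrt t"
proof -
  have D: "distributed M lborel (\<lambda>\<omega>. B t \<omega> - B 0 \<omega>) (normal_density 0 (sqrt t))"
    using normal_increments_BM[of 0 t] assms by simp
  have "{\<omega> \<in> space M. \<bar>B t \<omega> - B 0 \<omega>\<bar> \<le> R} = (\<lambda>\<omega>. B t \<omega> - B 0 \<omega>) -` {-R..R} \<inter> space M" by auto
  then have "emeasure M {\<omega> \<in> space M. \<bar>B t \<omega> - B 0 \<omega>\<bar> \<le> R}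
     = (\<integral>\<^sup>+x. ennreal (normal_density 0 (sqrt t) x) * indicator {-R..R} x \<partial>lborel)"
    using distributed_emeasure[OF D, of "{-R..R}"] by simp
  also have "\<dots> \<le> (\<integral>\<^sup>+x. ennreal (1 / sqrt t) * indicator {-R..R} x \<partial>lborel)"
  proof (intro nn_integral_mono mult_right_mono ennreal_leI)
    fix x
    have "1 \<le> sqrt (2 * pi)" using pi_ge_two by simp
    then have "1 * sqrt t \<le> sqrt (2 * pi) * sqrt t" using assms by (intro mult_right_mono) auto
    then have "1 / sqrt (2 * pi * t) \<le> 1 / sqrt t"
      using assms by (intro divide_left_mono) (auto simp: real_sqrt_mult)
    moreover have "exp (- x\<^sup>2 / (2 * t)) \<le> 1" using assms by simp
    ultimately have "1 / sqrt (2 * pi * t) * exp (- x\<^sup>2 / (2 * t)) \<le> 1 / sqrt t * 1"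
      using assms by (intro mult_mono) auto
    then show "normal_density 0 (sqrt t) x \<le> 1 / sqrt t"
      using assms by (simp add: normal_density_def)
  qed simp
  also have "\<dots> = ennreal (1 / sqrt t) * emeasure lborel {-R..R}"
    by (simp add: nn_integral_cmult)
  also have "\<dots> \<le> ennreal (1 / sqrt t) * ennreal (2 * \<bar>R\<bar>)"
    by (intro mult_left_mono) (auto simp: emeasure_lborel_Icc_eq intro!: ennreal_leI)
  also have "\<dots> = ennreal (2 * \<bar>R\<bar> / sqrt t)"
    using assms by (simp add: ennreal_mult[symmetric])
  finally show ?thesis
    using assms by (simp add: emeasure_eq_measure)
qed

text \<open>A path that stays within N of its start at all integer times does so in particular at
  time n, which has probability at most 2 N / sqrt n. As n is arbitrary, such confinement has
  probability 0 for each of the countably many N.\<close>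

lemma AE_BM_unbounded: "AE \<omega> in M. \<forall>R. \<exists>n::nat. R < \<bar>B (real n) \<omega>\<bar>"
proof -
  have "AE \<omega> in M. \<exists>n::nat. real N < \<bar>B (real n) \<omega> - B 0 \<omega>\<bar>" for N :: nat
  proof -
    let ?A = "\<lambda>n. {\<omega> \<in> space M. \<bar>B (real n) \<omega> - B 0 \<omega>\<bar> \<le> real N}"
    define A where "A = (\<Inter>n. ?A n)"
    have [measurable]: "B (real n) \<in> borel_measurable M" "B 0 \<in> borel_measurable M" for n :: nat
      using measurable_BM by auto
    have A[measurable]: "A \<in> sets M" unfolding A_def by measurable
    have le: "measure M A \<le> 2 * real N / sqrt (real n)" if "1 \<le> n" for n
    proof -
      have "measure M A \<le> measure M (?A n)"
        by (intro finite_measure_mono) (auto simp: A_def)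
      also have "\<dots> \<le> 2 * real N / sqrt (real n)"
        using prob_abs_BM_le[of "real n" "real N"] that by simp
      finally show ?thesis .
    qed
    have "(\<lambda>n. 2 * real N / sqrt (real n)) \<longlonglongrightarrow> 0" 
      by (intro tendsto_divide_0[OF tendsto_const] filterlim_compose[OF filterlim_at_top_imp_at_infinity[OF sqrt_at_top] filterlim_real_sequentially])
    then have "measure M A \<le> 0"
      by (rule LIMSEQ_le_const) (use le in blast)
    then have "emeasure M A = 0" by (simp add: emeasure_eq_measure measure_le_0_iff)
    then have "A \<in> null_sets M" using A by auto
    then have "AE \<omega> in M. \<omega> \<notin> A" by (rule AE_not_in)
    then show ?thesis using AE_space by eventually_elim (auto simp: A_def not_le)
  qed
  then have "AE \<omega> in M. \<forall>N. \<exists>n::nat. real N < \<bar>B (real n) \<omega> - B 0 \<omega>\<bar>" by (simp add: AE_all_countable)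
  then show ?thesis using start_BM
  proof eventually_elim
    case (elim \<omega>)
    show ?case
    proof
      fix R :: real
      obtain N :: nat where "R < real N" using reals_Archimedean2 by blast
      moreover obtain n :: nat where "real N < \<bar>B (real n) \<omega> - B 0 \<omega>\<bar>" using elim(1) by blast
      ultimately show "\<exists>n::nat. R < \<bar>B (real n) \<omega>\<bar>" using elim(2) by (intro exI[of _ n]) simp
    qed
  qed
qed

end

section \<open>Almost sure exponential bounds\<close>

text \<open>A union bound over exponentially many events and the Borel--Cantelli lemma in one step.\<close>

lemma AE_exponential_bound:
  fixes Y :: "nat \<Rightarrow> nat \<Rightarrow> 'a \<Rightarrow> ennreal"
  assumes Y[measurable]: "\<And>m j. Y m j \<in> borel_measurable M"
    and bound: "\<And>m j. j \<le> N * 2 ^ m \<Longrightarrow> (\<integral>\<^sup>+\<omega>. Y m j \<omega> \<partial>M) \<le> ennreal (C * exp (c * real m))"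
    and C: "0 \<le> C"
  shows "AE \<omega> in M. \<exists>S>0. \<forall>m. \<forall>j\<le>N * 2 ^ m. Y m j \<omega> \<le> ennreal (S * exp ((c + 2) * real m))"
proof -
  \<comment> \<open>The weight cancels the growth \<open>exp (c * real m)\<close> of the means and
    leaves \<open>exp (- 2 * real m)\<close>, which beats the number N 2^m + 1 of summands because 2
    exp (-2) < 1. So \<open>W\<close> has finite mean, and where it is finite it dominates every
    weighted term.\<close>
  define W where "W = (\<lambda>\<omega>. \<Sum>m. \<Sum>j\<le>N * 2 ^ m. ennreal (exp (- (c + 2) * real m)) * Y m j \<omega>)"
  have W[measurable]: "W \<in> borel_measurable M" unfolding W_def by measurable
  have e2: "2 * exp (- 2 :: real) < 1"
    using exp_ge_add_one_self[of "2::real"] by (simp add: exp_minus field_simps)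
  have "(\<integral>\<^sup>+\<omega>. W \<omega> \<partial>M)
      = (\<Sum>m. \<Sum>j\<le>N * 2 ^ m. ennreal (exp (- (c + 2) * real m)) * (\<integral>\<^sup>+\<omega>. Y m j \<omega> \<partial>M))"
    unfolding W_def by (simp add: nn_integral_suminf nn_integral_sum nn_integral_cmult)
  also have "\<dots> \<le> (\<Sum>m. ennreal (C * (real N + 1) * (2 * exp (- 2)) ^ m))"
  proof (intro suminf_le summableI)
    fix m
    have "(\<Sum>j\<le>N * 2 ^ m. ennreal (exp (- (c + 2) * real m)) * (\<integral>\<^sup>+\<omega>. Y m j \<omega> \<partial>M))
        \<le> (\<Sum>j\<le>N * 2 ^ m. ennreal (exp (- (c + 2) * real m)) * ennreal (C * exp (c * real m)))"
      by (intro sum_mono mult_left_mono bound) auto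
    also have "\<dots> = (\<Sum>j\<le>N * 2 ^ m. ennreal (C * exp (- 2 * real m)))"
      using C by (simp add: ennreal_mult[symmetric] mult_exp_exp algebra_simps)
    also have "\<dots> = ennreal ((real N * 2 ^ m + 1) * (C * exp (- 2 * real m)))"
      using C by (subst sum_ennreal) (simp_all add: add.commute)
    also have "\<dots> \<le> ennreal (C * (real N + 1) * (2 * exp (- 2)) ^ m)"
    proof (rule ennreal_leI)
      have "(real N * 2 ^ m + 1) * (C * exp (- 2 * real m)) \<le> ((real N + 1) * 2 ^ m) * (C * exp (- 2 * real m))"
        using C by (intro mult_right_mono) (auto simp: algebra_simps)
      also have "\<dots> = C * (real N + 1) * (2 * exp (- 2)) ^ m"
        unfolding power_mult_distrib exp_of_nat_mult[symmetric] by (simp add: mult.commute)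
      finally show "(real N * 2 ^ m + 1) * (C * exp (- 2 * real m)) \<le> C * (real N + 1) * (2 * exp (- 2)) ^ m" .
    qed
    finally show "(\<Sum>j\<le>N * 2 ^ m. ennreal (exp (- (c + 2) * real m)) * (\<integral>\<^sup>+\<omega>. Y m j \<omega> \<partial>M))
        \<le> ennreal (C * (real N + 1) * (2 * exp (- 2)) ^ m)" .
  qed
  also have "\<dots> < \<infinity>"
  proof -
    have "summable (\<lambda>m. C * (real N + 1) * (2 * exp (- 2)) ^ m)"
      using e2 by (intro summable_mult summable_geometric) auto
    then show ?thesis using C by (subst suminf_ennreal2) (auto simp: ennreal_less_top)
  qed
  finally have "AE \<omega> in M. W \<omega> \<noteq> \<infinity>" by (intro nn_integral_PInf_AE) auto
  then show ?thesis
  proof eventually_elim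
    case (elim \<omega>)
    define S where "S = enn2real (W \<omega>) + 1"
    have S: "0 < S" "W \<omega> \<le> ennreal S"
      using elim by (auto simp: S_def add_nonneg_pos ennreal_plus top.not_eq_extremum)
    have "Y m j \<omega> \<le> ennreal (S * exp ((c + 2) * real m))" if j: "j \<le> N * 2 ^ m" for m j
    proof -
      let ?e = "ennreal (exp (- (c + 2) * real m))"
      have "?e * Y m j \<omega> \<le> (\<Sum>j\<le>N * 2 ^ m. ?e * Y m j \<omega>)"
        using j by (intro member_le_sum) auto
      also have "\<dots> \<le> W \<omega>"
        unfolding W_def using sum_le_suminf[OF summableI, of "{m}" "\<lambda>m. \<Sum>j\<le>N * 2 ^ m. ennreal (exp (- (c + 2) * real m)) * Y m j \<omega>"]
        by simp
      also note S(2)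
      finally have "ennreal (exp ((c + 2) * real m)) * (?e * Y m j \<omega>) \<le> ennreal (exp ((c + 2) * real m)) * ennreal S"
        by (rule mult_left_mono) simp
      moreover have "ennreal (exp ((c + 2) * real m)) * ?e = 1"
        by (simp only: ennreal_mult[symmetric] mult_exp_exp exp_ge_zero mult_minus_left add.right_inverse
            exp_zero ennreal_1)
      ultimately show ?thesis
        using S(1) by (simp add: mult.assoc[symmetric] ennreal_mult mult.commute[of "ennreal S"])
    qed
    then show ?case using S(1) by blast
  qed
qed

lemma Liminf_le_const:
  fixes f :: "nat \<Rightarrow> 'b :: complete_linorder"
  assumes "\<forall>\<^sub>F n in sequentially. f n \<le> c"
  shows "liminf f \<le> c"
  using Liminf_mono[OF assms] by (simp add: Liminf_const)

lemma exp_abs_le_exp_plus_exp: "exp \<bar>x\<bar> \<le> exp x + exp (- x :: real)"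
  by (cases "0 \<le> x") auto

section \<open>Exponential moments of Brownian grid sums and increments\<close>

context brownian_motion
begin

lemma nn_integral_exp_increment:
  assumes "0 \<le> u" "u < v" "\<bar>\<kappa>\<bar> * (v - u) \<le> 1/4"
  shows "(\<integral>\<^sup>+x. ennreal (exp (c * x + \<kappa> * (x\<^sup>2 - (v - u)))) \<partial>distr M borel (\<lambda>\<omega>. B v \<omega> - B u \<omega>))
         \<le> ennreal (exp ((4 * \<kappa>\<^sup>2 * (v - u) + c\<^sup>2) * (v - u)))"
proof -
  have [measurable]: "B u \<in> borel_measurable M" "B v \<in> borel_measurable M"
    using measurable_BM assms by auto
  have "(\<integral>\<^sup>+x. ennreal (exp (c * x + \<kappa> * (x\<^sup>2 - (v - u)))) \<partial>distr M borel (\<lambda>\<omega>. B v \<omega> - B u \<omega>))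
      = (\<integral>\<^sup>+x. ennreal (normal_density 0 (sqrt (v - u)) x) * ennreal (exp (c * x + \<kappa> * (x\<^sup>2 - (v - u)))) \<partial>lborel)"
    using distributed_nn_integral[OF normal_increments_BM[OF assms(1,2)]] by (simp add: nn_integral_distr)
  also have "\<dots> \<le> ennreal (exp ((4 * \<kappa>\<^sup>2 * (v - u) + c\<^sup>2) * (v - u)))"
    using assms by (intro nn_integral_normal_density_exp_quadratic) auto
  finally show ?thesis .
qed

definition BM_grid_sum :: "real \<Rightarrow> real \<Rightarrow> real \<Rightarrow> nat \<Rightarrow> 'a \<Rightarrow> real" where
  "BM_grid_sum a \<epsilon> t n \<omega> = grid_sum a \<epsilon> (t / real n) n
     (\<lambda>i. B (real (Suc i) * (t / real n)) \<omega> - B (real i * (t / real n)) \<omega>)"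

lemma measurable_BM_grid_sum[measurable]:
  assumes "0 \<le> t"
  shows "BM_grid_sum a \<epsilon> t n \<in> borel_measurable M"
proof -
  let ?Z = "\<lambda>i \<omega>. B (real (Suc i) * (t / real n)) \<omega> - B (real i * (t / real n)) \<omega>"
  have Z[measurable]: "?Z i \<in> borel_measurable M" for i
    using assms by (intro borel_measurable_diff measurable_BM) auto
  have [measurable]: "(\<lambda>\<omega>. grid_gap a \<epsilon> i (\<lambda>l. ?Z l \<omega>)) \<in> borel_measurable M" for i
  proof -
    have "(\<lambda>\<omega>. restrict (\<lambda>l. ?Z l \<omega>) {..<i}) \<in> measurable M (PiM {..<i} (\<lambda>_. borel))"
      by (intro measurable_restrict Z)
    from measurable_compose[OF this measurable_grid_gap] show ?thesis
      by (simp only: grid_gap_restrict)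
  qed
  show ?thesis unfolding BM_grid_sum_def grid_sum_def by measurable
qed

text \<open>The clamp bounds the coefficient of each increment by
  \<open>2 * \<bar>\<kappa>\<bar> * a\<close>, and a mesh of at most \<open>a\<^sup>2\<close> gives
  the quadratic term the same size, whence 8 = 4 + 4. The bound depends neither on the mesh nor on
  \<open>\<epsilon>\<close>, as Fatou's lemma requires.\<close>

lemma nn_integral_exp_BM_grid_sum:
  assumes a: "0 < a" and t: "0 < t" and n: "0 < n"
    and \<kappa>: "\<bar>\<kappa>\<bar> * (t / real n) \<le> 1/4" and mesh: "t / real n \<le> a\<^sup>2"
  shows "(\<integral>\<^sup>+\<omega>. ennreal (exp (\<kappa> * BM_grid_sum a \<epsilon> t n \<omega>)) \<partial>M) \<le> ennreal (exp (8 * \<kappa>\<^sup>2 * a\<^sup>2 * t))"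
proof -
  define \<delta> where "\<delta> = t / real n"
  have \<delta>: "0 < \<delta>" using t n by (simp add: \<delta>_def)
  define Z where "Z = (\<lambda>i \<omega>. B (real (Suc i) * \<delta>) \<omega> - B (real i * \<delta>) \<omega>)"
  have ind: "indep_vars (\<lambda>_. borel) Z {..<n}"
    unfolding Z_def using \<delta> by (intro indep_increments_BM) auto
  have step: "(\<integral>\<^sup>+x. ennreal (exp (2 * \<kappa> * grid_gap a \<epsilon> j z * x + \<kappa> * (x\<^sup>2 - \<delta>))) \<partial>distr M borel (Z j))
      \<le> ennreal (exp (8 * \<kappa>\<^sup>2 * a\<^sup>2 * \<delta>))" for j z
  proof -
    let ?c = "2 * \<kappa> * grid_gap a \<epsilon> j z"
    have d: "real (Suc j) * \<delta> - real j * \<delta> = \<delta>" by (simp add: algebra_simps)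
    have "(\<integral>\<^sup>+x. ennreal (exp (?c * x + \<kappa> * (x\<^sup>2 - \<delta>))) \<partial>distr M borel (Z j))
        \<le> ennreal (exp ((4 * \<kappa>\<^sup>2 * \<delta> + ?c\<^sup>2) * \<delta>))"
      using nn_integral_exp_increment[of "real j * \<delta>" "real (Suc j) * \<delta>" \<kappa> ?c] \<delta> \<kappa>
      unfolding d Z_def[symmetric] \<delta>_def[symmetric] by (simp add: Z_def)
    also have "\<dots> \<le> ennreal (exp (8 * \<kappa>\<^sup>2 * a\<^sup>2 * \<delta>))"
    proof (intro ennreal_leI, subst exp_le_cancel_iff, intro mult_right_mono)
      have "(grid_gap a \<epsilon> j z)\<^sup>2 \<le> a\<^sup>2"
        using clamp_abs_le[of a] a unfolding grid_gap_def by (simp add: abs_le_square_iff[symmetric])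
      then have "4 * \<kappa>\<^sup>2 * (grid_gap a \<epsilon> j z)\<^sup>2 \<le> 4 * \<kappa>\<^sup>2 * a\<^sup>2" by (intro mult_left_mono) auto
      moreover have "4 * \<kappa>\<^sup>2 * \<delta> \<le> 4 * \<kappa>\<^sup>2 * a\<^sup>2"
        using mesh by (intro mult_left_mono) (auto simp: \<delta>_def)
      ultimately show "4 * \<kappa>\<^sup>2 * \<delta> + ?c\<^sup>2 \<le> 8 * \<kappa>\<^sup>2 * a\<^sup>2" by (simp add: power_mult_distrib)
    qed (use \<delta> in simp)
    finally show ?thesis .
  qed
  have "(\<integral>\<^sup>+\<omega>. ennreal (exp (\<Sum>j<n. 2 * \<kappa> * grid_gap a \<epsilon> j (\<lambda>i. Z i \<omega>) * Z j \<omega> + \<kappa> * ((Z j \<omega>)\<^sup>2 - \<delta>))) \<partial>M)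
      \<le> ennreal (exp (8 * \<kappa>\<^sup>2 * a\<^sup>2 * \<delta>) ^ n)"
    using nn_integral_exp_predictable_sum_le[OF ind, of "\<lambda>j z. 2 * \<kappa> * grid_gap a \<epsilon> j z"
        "\<lambda>x. \<kappa> * (x\<^sup>2 - \<delta>)" "exp (8 * \<kappa>\<^sup>2 * a\<^sup>2 * \<delta>)"] step
    by (simp add: grid_gap_restrict borel_measurable_times measurable_grid_gap)
  moreover have "(\<Sum>j<n. 2 * \<kappa> * grid_gap a \<epsilon> j (\<lambda>i. Z i \<omega>) * Z j \<omega> + \<kappa> * ((Z j \<omega>)\<^sup>2 - \<delta>))
      = \<kappa> * BM_grid_sum a \<epsilon> t n \<omega>" for \<omega>
    unfolding BM_grid_sum_def grid_sum_def \<delta>_def[symmetric] Z_def[symmetric]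
    by (simp add: Z_def sum_distrib_left algebra_simps)
  moreover have "exp (8 * \<kappa>\<^sup>2 * a\<^sup>2 * \<delta>) ^ n = exp (8 * \<kappa>\<^sup>2 * a\<^sup>2 * t)"
    using n by (simp add: exp_of_nat_mult[symmetric] \<delta>_def)
  ultimately show ?thesis by simp
qed

text \<open>The two lower limits refine first the mesh and then the tolerance; the integral bound survives
  by Fatou's lemma.\<close>

definition deviation_bound :: "real \<Rightarrow> real \<Rightarrow> real \<Rightarrow> 'a \<Rightarrow> ennreal" where
  "deviation_bound a \<kappa> t \<omega> = liminf (\<lambda>l. liminf (\<lambda>n.
     ennreal (exp (\<kappa> * BM_grid_sum a (1 / real (Suc l)) t n \<omega>)) +
     ennreal (exp (- \<kappa> * BM_grid_sum a (1 / real (Suc l)) t n \<omega>))))"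

lemma measurable_deviation_bound[measurable]:
  assumes "0 \<le> t" shows "deviation_bound a \<kappa> t \<in> borel_measurable M"
proof -
  have [measurable]: "BM_grid_sum a \<epsilon> t n \<in> borel_measurable M" for \<epsilon> n
    using assms by (rule measurable_BM_grid_sum)
  show ?thesis unfolding deviation_bound_def by measurable
qed

lemma nn_integral_deviation_bound:
  assumes a: "0 < a" and t: "0 < t"
  shows "(\<integral>\<^sup>+\<omega>. deviation_bound a \<kappa> t \<omega> \<partial>M) \<le> ennreal (2 * exp (8 * \<kappa>\<^sup>2 * a\<^sup>2 * t))"
proof -
  have [measurable]: "BM_grid_sum a \<epsilon> t n \<in> borel_measurable M" for \<epsilon> n
    using t by (intro measurable_BM_grid_sum) simp
  define E where "E = (\<lambda>l n \<omega>. ennreal (exp (\<kappa> * BM_grid_sum a (1 / real (Suc l)) t n \<omega>)) +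
     ennreal (exp (- \<kappa> * BM_grid_sum a (1 / real (Suc l)) t n \<omega>)))"
  have [measurable]: "E l n \<in> borel_measurable M" for l n unfolding E_def by measurable
  let ?K = "ennreal (2 * exp (8 * \<kappa>\<^sup>2 * a\<^sup>2 * t))"
  have "\<forall>\<^sub>F n in sequentially. (\<integral>\<^sup>+\<omega>. E l n \<omega> \<partial>M) \<le> ?K" for l
  proof -
    have "(\<lambda>n. t / real n) \<longlonglongrightarrow> 0" by (rule lim_const_over_n)
    then have "\<forall>\<^sub>F n in sequentially. t / real n < min (a\<^sup>2) (1 / (4 * (\<bar>\<kappa>\<bar> + 1)))"
      by (rule order_tendstoD) (use a in simp)
    then show ?thesis using eventually_gt_at_top[of 0]
    proof eventually_elim
      case (elim n)
      have "\<bar>\<kappa>\<bar> * (t / real n) \<le> (\<bar>\<kappa>\<bar> + 1) * (1 / (4 * (\<bar>\<kappa>\<bar> + 1)))"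
        using elim t by (intro mult_mono) auto
      also have "\<dots> = 1/4" by (simp add: field_simps)
      finally have k: "\<bar>\<kappa>\<bar> * (t / real n) \<le> 1/4" .
      have "(\<integral>\<^sup>+\<omega>. E l n \<omega> \<partial>M) \<le> ennreal (exp (8 * \<kappa>\<^sup>2 * a\<^sup>2 * t)) + ennreal (exp (8 * \<kappa>\<^sup>2 * a\<^sup>2 * t))"
        unfolding E_def
        using nn_integral_exp_BM_grid_sum[OF a t elim(2) k, of "1 / real (Suc l)"]
          nn_integral_exp_BM_grid_sum[OF a t elim(2), of "- \<kappa>" "1 / real (Suc l)"] k elim(1)
        by (subst nn_integral_add) (auto intro!: add_mono)
      also have "\<dots> = ?K" by (simp add: ennreal_plus[symmetric] del: ennreal_plus)
      finally show ?case .
    qed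
  qed
  then have inner: "(\<integral>\<^sup>+\<omega>. liminf (\<lambda>n. E l n \<omega>) \<partial>M) \<le> ?K" for l
    by (intro order_trans[OF nn_integral_liminf] Liminf_le_const) auto
  have "(\<integral>\<^sup>+\<omega>. liminf (\<lambda>l. liminf (\<lambda>n. E l n \<omega>)) \<partial>M) \<le> ?K"
    using inner by (intro order_trans[OF nn_integral_liminf] Liminf_le_const) auto
  then show ?thesis by (simp add: deviation_bound_def E_def)
qed

text \<open>The admissible tolerance depends on the path, and so does a mesh fine enough for it.
  Lower limits absorb this, since the inequality holds eventually in \<open>l\<close> and then
  eventually in \<open>n\<close>. The two signs of \<open>\<kappa>\<close> in
  \<open>deviation_bound\<close> take care of the absolute value.\<close>

lemma deviation_bound_ge:
  assumes b: "continuous_on {0..} (\<lambda>u. B u \<omega>)" and b0: "B 0 \<omega> = 0" and a: "0 < a" and \<kappa>: "0 \<le> \<kappa>"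
    and s: "exit_times a (\<lambda>u. B u \<omega>) s" and t: "0 < t" and K: "s K \<le> t" "t < s (Suc K)"
  shows "ennreal (exp (\<kappa> * (\<bar>real K * a\<^sup>2 - t\<bar> - 3 * a\<^sup>2))) \<le> deviation_bound a \<kappa> t \<omega>"
proof -
  obtain \<epsilon>0 where \<epsilon>0: "0 < \<epsilon>0" and approx: "\<And>\<epsilon>. 0 < \<epsilon> \<Longrightarrow> \<epsilon> < \<epsilon>0 \<Longrightarrow>
      \<forall>\<^sub>F n in sequentially. \<bar>real K * a\<^sup>2 - t\<bar> \<le> \<bar>BM_grid_sum a \<epsilon> t n \<omega>\<bar> + 3 * a\<^sup>2"
    using grid_sum_approximates[OF b b0 a s t K] unfolding BM_grid_sum_def by blast
  have "(\<lambda>l. 1 / real (Suc l)) \<longlonglongrightarrow> 0" using lim_inverse_n' LIMSEQ_Suc by blast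
  then have "\<forall>\<^sub>F l in sequentially. 1 / real (Suc l) < \<epsilon>0"
    by (rule order_tendstoD) (rule \<epsilon>0)
  then show ?thesis unfolding deviation_bound_def
  proof (intro Liminf_bounded, eventually_elim)
    case (elim l)
    have "\<forall>\<^sub>F n in sequentially. \<bar>real K * a\<^sup>2 - t\<bar> \<le> \<bar>BM_grid_sum a (1 / real (Suc l)) t n \<omega>\<bar> + 3 * a\<^sup>2"
      using elim by (intro approx) auto
    then show ?case
    proof (intro Liminf_bounded, eventually_elim)
      case (elim n)
      let ?G = "BM_grid_sum a (1 / real (Suc l)) t n \<omega>"
      have "\<kappa> * (\<bar>real K * a\<^sup>2 - t\<bar> - 3 * a\<^sup>2) \<le> \<kappa> * \<bar>?G\<bar>"
        using elim \<kappa> by (intro mult_left_mono) auto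
      also have "\<dots> = \<bar>\<kappa> * ?G\<bar>" using \<kappa> by (simp add: abs_mult)
      finally have "exp (\<kappa> * (\<bar>real K * a\<^sup>2 - t\<bar> - 3 * a\<^sup>2)) \<le> exp \<bar>\<kappa> * ?G\<bar>" by simp
      also note exp_abs_le_exp_plus_exp
      finally show ?case by (simp add: ennreal_plus[symmetric] del: ennreal_plus) 
    qed
  qed
qed

text \<open>With a = 2^(-m), the choice \<open>\<kappa> m = sqrt (real m) * 2 ^ m\<close> makes the
  exponent \<open>8 * \<kappa>\<^sup>2 * a\<^sup>2 * t\<close> linear in \<open>m\<close>, the
  growth that \<open>AE_exponential_bound\<close> handles. Logarithms then bound
  \<open>\<kappa>\<close> times the deviation by O(m), and division by \<open>\<kappa>\<close>
  leaves \<open>sqrt (real m) / 2 ^ m\<close>. Writing the times with \<open>Suc j\<close> keeps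
  them positive.\<close>

lemma AE_exit_count:
  fixes N :: nat
  shows "AE \<omega> in M. \<exists>C\<ge>0. \<forall>m\<ge>1. \<forall>j\<le>N * 2 ^ m. \<forall>K.
    skorohod_time B m K \<omega> \<le> real (Suc j) / 2 ^ m \<and> real (Suc j) / 2 ^ m < skorohod_time B m (Suc K) \<omega> \<longrightarrow>
    \<bar>real K * (1 / 2 ^ m)\<^sup>2 - real (Suc j) / 2 ^ m\<bar> \<le> C * (sqrt (real m) / 2 ^ m)"
proof -
  define \<kappa> where "\<kappa> = (\<lambda>m::nat. sqrt (real m) * 2 ^ m)"
  define Y where "Y = (\<lambda>m j. deviation_bound (1 / 2 ^ m) (\<kappa> m) (real (Suc j) / 2 ^ m))"
  define c where "c = 8 * (real N + 1)"
  have Y: "Y m j \<in> borel_measurable M" for m j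
    unfolding Y_def by (intro measurable_deviation_bound) auto
  have "(\<integral>\<^sup>+\<omega>. Y m j \<omega> \<partial>M) \<le> ennreal (2 * exp (c * real m))" if "j \<le> N * 2 ^ m" for m j
  proof -
    have "real j \<le> real N * 2 ^ m" using of_nat_mono[OF that] by simp
    then have "real (Suc j) \<le> (real N + 1) * 2 ^ m"
      unfolding of_nat_Suc distrib_right using one_le_power[of "2::real" m] by linarith
    then have t: "real (Suc j) / 2 ^ m \<le> real N + 1" by (simp add: field_simps)
    have "8 * (\<kappa> m)\<^sup>2 * (1 / 2 ^ m)\<^sup>2 * (real (Suc j) / 2 ^ m) = 8 * real m * (real (Suc j) / 2 ^ m)"
      by (simp add: \<kappa>_def power_mult_distrib power_divide del: of_nat_Suc)
    also have "\<dots> \<le> 8 * real m * (real N + 1)" using t by (intro mult_left_mono) auto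
    also have "\<dots> = c * real m" by (simp add: c_def)
    finally have "exp (8 * (\<kappa> m)\<^sup>2 * (1 / 2 ^ m)\<^sup>2 * (real (Suc j) / 2 ^ m)) \<le> exp (c * real m)" by simp
    then have "ennreal (2 * exp (8 * (\<kappa> m)\<^sup>2 * (1 / 2 ^ m)\<^sup>2 * (real (Suc j) / 2 ^ m))) \<le> ennreal (2 * exp (c * real m))"
      by (intro ennreal_leI) linarith
    moreover have "(\<integral>\<^sup>+\<omega>. Y m j \<omega> \<partial>M) \<le> ennreal (2 * exp (8 * (\<kappa> m)\<^sup>2 * (1 / 2 ^ m)\<^sup>2 * (real (Suc j) / 2 ^ m)))"
      unfolding Y_def by (rule nn_integral_deviation_bound) auto
    ultimately show ?thesis by (rule order_trans[rotated])
  qed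
  then have "AE \<omega> in M. \<exists>S>0. \<forall>m. \<forall>j\<le>N * 2 ^ m. Y m j \<omega> \<le> ennreal (S * exp ((c + 2) * real m))"
    using Y by (intro AE_exponential_bound) auto
  then show ?thesis using start_BM continuous_BM AE_BM_unbounded
  proof eventually_elim
    case (elim \<omega>)
    then obtain S where S: "0 < S" "\<And>m j. j \<le> N * 2 ^ m \<Longrightarrow> Y m j \<omega> \<le> ennreal (S * exp ((c + 2) * real m))"
      by blast
    define C where "C = 3 + \<bar>ln S\<bar> + (c + 2)"
    have C: "0 \<le> C" by (simp add: C_def c_def)
    have "\<bar>real K * (1 / 2 ^ m)\<^sup>2 - t\<bar> \<le> C * (sqrt (real m) / 2 ^ m)"
      if m: "1 \<le> m" and j: "j \<le> N * 2 ^ m" and t: "t = real (Suc j) / 2 ^ m"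
        and K: "skorohod_time B m K \<omega> \<le> t" "t < skorohod_time B m (Suc K) \<omega>" for m j K t
    proof -
      define a :: real where "a = 1 / 2 ^ m"
      let ?x = "\<bar>real K * a\<^sup>2 - t\<bar>"
      have a: "0 < a" "a \<le> 1" by (auto simp: a_def)
      have r: "1 \<le> sqrt (real m)" using m by simp
      have ex: "exit_times a (\<lambda>u. B u \<omega>) (\<lambda>k. skorohod_time B m k \<omega>)"
        unfolding a_def using elim by (intro exit_times_skorohod_time) auto
      have \<kappa>a: "\<kappa> m = sqrt (real m) / a" by (simp add: \<kappa>_def a_def)
      have "ennreal (exp (\<kappa> m * (?x - 3 * a\<^sup>2))) \<le> deviation_bound a (\<kappa> m) t \<omega>"
        by (rule deviation_bound_ge[OF _ _ a(1) _ ex _ K]) (use elim t in \<open>auto simp: \<kappa>_def\<close>)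
      also have "\<dots> \<le> ennreal (S * exp ((c + 2) * real m))"
        using S(2)[OF j] by (simp add: Y_def a_def t)
      also have "S * exp ((c + 2) * real m) = exp (ln S + (c + 2) * real m)"
        using S(1) by (simp add: exp_add)
      finally have "\<kappa> m * (?x - 3 * a\<^sup>2) \<le> ln S + (c + 2) * real m" by simp
      then have "sqrt (real m) * (?x - 3 * a\<^sup>2) \<le> (ln S + (c + 2) * real m) * a"
        using a by (simp add: \<kappa>a field_simps)
      also have "\<dots> \<le> ((\<bar>ln S\<bar> + (c + 2)) * real m) * a"
      proof (intro mult_right_mono)
        have "\<bar>ln S\<bar> * 1 \<le> \<bar>ln S\<bar> * real m" using m by (intro mult_left_mono) auto
        then show "ln S + (c + 2) * real m \<le> (\<bar>ln S\<bar> + (c + 2)) * real m"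
          by (simp add: algebra_simps)
      qed (use a in simp)
      also have "\<dots> = sqrt (real m) * ((\<bar>ln S\<bar> + (c + 2)) * (sqrt (real m) * a))" by simp
      finally have "?x - 3 * a\<^sup>2 \<le> (\<bar>ln S\<bar> + (c + 2)) * (sqrt (real m) * a)"
        using r by simp
      moreover have "a\<^sup>2 \<le> sqrt (real m) * a"
      proof -
        have "a \<le> sqrt (real m)" using a r by linarith
        then show ?thesis using a by (simp add: power2_eq_square)
      qed
      ultimately have "?x \<le> C * (sqrt (real m) * a)" by (simp add: C_def algebra_simps)
      then show ?thesis by (simp add: a_def)
    qed
    then show ?case using C by blast
  qed
qed

text \<open>The scheme of \<open>AE_exit_count\<close> for Gaussian increments of variance 2^(-l):
  \<open>\<theta>\<close> is chosen so that \<open>(\<theta> l)\<^sup>2 / 2 ^ l\<close> equals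
  \<open>real l + 1\<close>, and a logarithm of order l + 1 is divided by \<open>\<theta> l\<close>.
  The shift by 1 keeps \<open>\<theta>\<close> positive at level 0.\<close>

lemma AE_dyadic_increments:
  fixes N :: nat
  shows "AE \<omega> in M. \<exists>C\<ge>0. \<forall>l. \<forall>j\<le>N * 2 ^ l.
    \<bar>B (real (Suc j) / 2 ^ l) \<omega> - B (real j / 2 ^ l) \<omega>\<bar> \<le> C * (sqrt (real l + 1) / sqrt (2 ^ l))"
proof -
  define \<theta> where "\<theta> = (\<lambda>l::nat. sqrt (real l + 1) * sqrt (2 ^ l))"
  define x where "x = (\<lambda>l j \<omega>. B (real (Suc j) / 2 ^ l) \<omega> - B (real j / 2 ^ l) \<omega>)"
  define Y where "Y = (\<lambda>l j \<omega>. ennreal (exp (\<theta> l * x l j \<omega>)) + ennreal (exp (- \<theta> l * x l j \<omega>)))"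
  have [measurable]: "x l j \<in> borel_measurable M" for l j
    unfolding x_def by (intro borel_measurable_diff measurable_BM) auto
  have Y: "Y l j \<in> borel_measurable M" for l j unfolding Y_def by measurable
  have mgf: "(\<integral>\<^sup>+\<omega>. ennreal (exp (c * x l j \<omega>)) \<partial>M) \<le> ennreal (exp (c\<^sup>2 / 2 ^ l))" for c l j
  proof -
    have d: "real (Suc j) / 2 ^ l - real j / 2 ^ l = 1 / 2 ^ l" by (simp add: field_simps)
    have e: "(\<lambda>\<omega>. B (real (Suc j) / 2 ^ l) \<omega> - B (real j / 2 ^ l) \<omega>) = x l j" by (simp add: x_def)
    show ?thesis
      using nn_integral_exp_increment[of "real j / 2 ^ l" "real (Suc j) / 2 ^ l" 0 c, unfolded e d]
      by (simp add: nn_integral_distr divide_strict_right_mono)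
  qed
  have "(\<integral>\<^sup>+\<omega>. Y l j \<omega> \<partial>M) \<le> ennreal (2 * exp 1 * exp (1 * real l))" for l j
  proof -
    have "(\<theta> l)\<^sup>2 / 2 ^ l = 1 + real l" by (simp add: \<theta>_def power_mult_distrib)
    then have "(\<integral>\<^sup>+\<omega>. Y l j \<omega> \<partial>M) \<le> ennreal (exp (1 + real l)) + ennreal (exp (1 + real l))"
      using mgf[of "\<theta> l" l j] mgf[of "- \<theta> l" l j] unfolding Y_def
      by (subst nn_integral_add) (auto intro!: add_mono)
    also have "\<dots> = ennreal (2 * exp 1 * exp (1 * real l))"
      by (simp add: ennreal_plus[symmetric] exp_add del: ennreal_plus)
    finally show ?thesis .
  qed
  then have "AE \<omega> in M. \<exists>S>0. \<forall>l. \<forall>j\<le>N * 2 ^ l. Y l j \<omega> \<le> ennreal (S * exp ((1 + 2) * real l))"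
    using Y by (intro AE_exponential_bound) auto
  then show ?thesis
  proof eventually_elim
    case (elim \<omega>)
    then obtain S where S: "0 < S" "\<And>l j. j \<le> N * 2 ^ l \<Longrightarrow> Y l j \<omega> \<le> ennreal (S * exp ((1 + 2) * real l))"
      by blast
    have "\<bar>x l j \<omega>\<bar> \<le> (\<bar>ln S\<bar> + 3) * (sqrt (real l + 1) / sqrt (2 ^ l))" if j: "j \<le> N * 2 ^ l" for l j
    proof -
      have th: "0 < \<theta> l" by (simp add: \<theta>_def)
      have "ennreal (exp \<bar>\<theta> l * x l j \<omega>\<bar>) \<le> Y l j \<omega>"
        using exp_abs_le_exp_plus_exp[of "\<theta> l * x l j \<omega>"]
        unfolding Y_def by (simp add: ennreal_plus[symmetric] del: ennreal_plus)
      also have "\<dots> \<le> ennreal (S * exp ((1 + 2) * real l))" by (rule S(2)[OF j])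
      also have "S * exp ((1 + 2) * real l) = exp (ln S + 3 * real l)"
        using S(1) by (simp add: exp_add)
      finally have "\<theta> l * \<bar>x l j \<omega>\<bar> \<le> ln S + 3 * real l" using th by (simp add: abs_mult)
      also have "\<dots> \<le> (\<bar>ln S\<bar> + 3) * (real l + 1)"
      proof -
        have "0 \<le> \<bar>ln S\<bar> * real l" by simp
        then show ?thesis unfolding distrib_left distrib_right using abs_ge_self[of "ln S"] by linarith
      qed
      also have "\<dots> = \<theta> l * ((\<bar>ln S\<bar> + 3) * (sqrt (real l + 1) / sqrt (2 ^ l)))"
        by (simp add: \<theta>_def)
      finally show ?thesis using th by (rule mult_left_le_imp_le)
    qed
    then show ?case unfolding x_def by (intro exI[of _ "\<bar>ln S\<bar> + 3"]) auto
  qed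
qed

end

section \<open>Modulus of continuity and rate of approximation\<close>

lemma nat_le_of_real_le_power:
  assumes "real j \<le> real N * 2 ^ l"
  shows "j \<le> N * 2 ^ l"
proof -
  have "real j \<le> real (N * 2 ^ l)" using assms by simp
  then show ?thesis by (simp only: of_nat_le_iff)
qed

text \<open>The point is approached by its roundings down to levels n, n + 1, and so on. Consecutive
  roundings differ by at most one dyadic step, and the series of increments is geometric up to a
  polynomial factor, so its sum is of the order of the bound at level n.\<close>

lemma dyadic_chaining:
  fixes b :: "real \<Rightarrow> real" and N :: nat
  assumes b: "continuous_on {0..} b" and C: "0 \<le> C"
    and inc: "\<And>l j. j \<le> N * 2 ^ l \<Longrightarrow>
        \<bar>b (real (Suc j) / 2 ^ l) - b (real j / 2 ^ l)\<bar> \<le> C * (sqrt (real l + 1) / sqrt (2 ^ l))"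
  obtains D where "0 \<le> D" "\<And>n u. \<lbrakk>0 \<le> u; u \<le> real N\<rbrakk> \<Longrightarrow>
      \<bar>b u - b (real (nat \<lfloor>u * 2 ^ n\<rfloor>) / 2 ^ n)\<bar> \<le> D * (sqrt (real n + 1) / sqrt (2 ^ n))"
proof -
  define q where "q = 1 / sqrt (2::real)"
  have q: "0 < q" "q < 1" by (auto simp: q_def)
  have qpow: "1 / sqrt (2 ^ l) = q ^ l" for l by (simp add: q_def real_sqrt_power power_one_over)
  have "(\<lambda>k. real (Suc k) * q ^ k) sums (1 / (1 - q)\<^sup>2)"
    using q by (intro geometric_deriv_sums) auto
  moreover have "(\<lambda>k. q ^ k) sums (1 / (1 - q))" using q by (intro geometric_sums) auto
  ultimately have "(\<lambda>k. real (Suc k) * q ^ k + q ^ k) sums (1 / (1 - q)\<^sup>2 + 1 / (1 - q))"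
    by (rule sums_add)
  then have "(\<lambda>k. (real k + 2) * q ^ k) sums (1 / (1 - q)\<^sup>2 + 1 / (1 - q))"
    by (simp add: algebra_simps)
  then have summ: "summable (\<lambda>k. (real k + 2) * q ^ k)" by (rule sums_summable)
  define A where "A = (\<Sum>k. (real k + 2) * q ^ k)"
  have A: "(\<Sum>i<k. (real i + 2) * q ^ i) \<le> A" for k
    unfolding A_def using q by (intro sum_le_suminf summ) auto
  have A0: "0 \<le> A" using A[of 0] by simp
  have "\<bar>b u - b (real (nat \<lfloor>u * 2 ^ n\<rfloor>) / 2 ^ n)\<bar> \<le> (C * A) * (sqrt (real n + 1) / sqrt (2 ^ n))"
    if u: "0 \<le> u" "u \<le> real N" for n u
  proof -
    define j where "j = (\<lambda>l::nat. nat \<lfloor>u * 2 ^ l\<rfloor>)"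
    define f where "f = (\<lambda>l. real (j l) / 2 ^ l)"
    have jb: "real (j l) \<le> u * 2 ^ l" "u * 2 ^ l < real (j l) + 1" for l
      using u by (auto simp: j_def of_nat_nat)
    have fb: "u - 1 / 2 ^ l \<le> f l" "f l \<le> u" for l
    proof -
      have "(u - 1 / 2 ^ l) * 2 ^ l \<le> real (j l)" using jb[of l] by (simp add: left_diff_distrib)
      then show "u - 1 / 2 ^ l \<le> f l" unfolding f_def by (subst pos_le_divide_eq) auto
      show "f l \<le> u" using jb[of l] by (simp add: f_def pos_divide_le_eq)
    qed
    have jN: "j l \<le> N * 2 ^ l" for l
    proof -
      have "real (j l) \<le> real N * 2 ^ l"
        using jb(1)[of l] u by (meson mult_right_mono order_trans zero_le_numeral zero_le_power)
      then show ?thesis by (rule nat_le_of_real_le_power)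
    qed
    \<comment> \<open>Passing to the next level doubles the floor, or doubles it and adds 1; in the
      first case the rounded point does not move.\<close>
    have one: "\<bar>b (f (Suc l)) - b (f l)\<bar> \<le> C * (sqrt (real l + 2) * q ^ Suc l)" for l
    proof -
      have "2 * real (j l) \<le> u * 2 ^ Suc l" "u * 2 ^ Suc l < 2 * real (j l) + 2"
        using jb[of l] by (auto simp: algebra_simps)
      then have "2 * real (j l) < real (j (Suc l)) + 1" "real (j (Suc l)) < 2 * real (j l) + 2"
        using jb[of "Suc l"] by linarith+
      then have "j (Suc l) = 2 * j l \<or> j (Suc l) = Suc (2 * j l)" by linarith
      moreover have fl: "f l = real (2 * j l) / 2 ^ Suc l" by (simp add: f_def)
      moreover have "\<bar>b (real (Suc (2 * j l)) / 2 ^ Suc l) - b (real (2 * j l) / 2 ^ Suc l)\<bar>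
          \<le> C * (sqrt (real (Suc l) + 1) / sqrt (2 ^ Suc l))"
        using jN[of l] by (intro inc) simp
      moreover have "sqrt (real (Suc l) + 1) / sqrt (2 ^ Suc l) = sqrt (real l + 2) * q ^ Suc l"
        unfolding qpow[symmetric] by (simp add: add.commute)
      moreover have "0 \<le> C * (sqrt (real l + 2) * q ^ Suc l)" using C q by simp
      ultimately show ?thesis
        by (auto simp: f_def simp del: power_Suc of_nat_Suc of_nat_mult)
    qed
    have chain: "\<bar>b (f (n + k)) - b (f n)\<bar> \<le> C * (sqrt (real n + 1) * q ^ n) * (\<Sum>i<k. (real i + 2) * q ^ i)" for k
    proof (induction k)
      case (Suc k)
      \<comment> \<open>This separates the level n from the summation index, so that one constant
        \<open>A\<close> serves all levels; the square root of k + 2 is then bounded crudely by k +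
        2.\<close>
      have "real (n + k) + 2 \<le> (real n + 1) * (real k + 2)" by (simp add: algebra_simps)
      then have "sqrt (real (n + k) + 2) \<le> sqrt (real n + 1) * sqrt (real k + 2)"
        by (simp add: real_sqrt_mult[symmetric])
      also have "\<dots> \<le> sqrt (real n + 1) * (real k + 2)"
        by (intro mult_left_mono real_le_lsqrt) (auto simp: power2_eq_square algebra_simps)
      finally have "sqrt (real (n + k) + 2) \<le> sqrt (real n + 1) * (real k + 2)" .
      moreover have "q ^ Suc (n + k) \<le> q ^ n * q ^ k"
        using q by (simp add: power_add[symmetric] mult_left_le_one_le)
      ultimately have "sqrt (real (n + k) + 2) * q ^ Suc (n + k) \<le> (sqrt (real n + 1) * (real k + 2)) * (q ^ n * q ^ k)"
        using q by (intro mult_mono) auto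
      then have "C * (sqrt (real (n + k) + 2) * q ^ Suc (n + k)) \<le> C * ((sqrt (real n + 1) * (real k + 2)) * (q ^ n * q ^ k))"
        using C by (rule mult_left_mono)
      then have "\<bar>b (f (n + Suc k)) - b (f (n + k))\<bar> \<le> C * (sqrt (real n + 1) * q ^ n) * ((real k + 2) * q ^ k)"
        using one[of "n + k"] by (simp add: mult_ac)
      then show ?case using Suc by (simp add: distrib_left)
    qed simp
    have "(\<lambda>k. f (n + k)) \<longlonglongrightarrow> u"
    proof (rule tendsto_sandwich)
      show "(\<lambda>k. u - 1 / 2 ^ (n + k)) \<longlonglongrightarrow> u" by real_asymp
    qed (use fb in auto)
    then have "(\<lambda>k. b (f (n + k))) \<longlonglongrightarrow> b u"
      by (rule continuous_on_tendsto_compose[OF b]) (use u in \<open>auto simp: f_def\<close>)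
    then have "(\<lambda>k. \<bar>b (f (n + k)) - b (f n)\<bar>) \<longlonglongrightarrow> \<bar>b u - b (f n)\<bar>"
      by (intro tendsto_intros)
    moreover have "\<bar>b (f (n + k)) - b (f n)\<bar> \<le> C * (sqrt (real n + 1) * q ^ n) * A" for k
      using C q by (intro order_trans[OF chain mult_left_mono[OF A]]) auto
    ultimately have "\<bar>b u - b (f n)\<bar> \<le> C * (sqrt (real n + 1) * q ^ n) * A"
      by (intro LIMSEQ_le_const2) auto
    then show ?thesis unfolding f_def j_def qpow[symmetric] by (simp add: field_simps)
  qed
  then show ?thesis using that[of "C * A"] C A0 by simp
qed

text \<open>Both points are rounded down to level n, at the cost given by
  \<open>dyadic_chaining\<close>; the roundings are at most R + 1 steps of that level apart.\<close>

lemma dyadic_modulus_of_continuity: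
  fixes b :: "real \<Rightarrow> real" and N :: nat
  assumes b: "continuous_on {0..} b" and C: "0 \<le> C" and R: "0 \<le> R"
    and inc: "\<And>l j. j \<le> N * 2 ^ l \<Longrightarrow>
        \<bar>b (real (Suc j) / 2 ^ l) - b (real j / 2 ^ l)\<bar> \<le> C * (sqrt (real l + 1) / sqrt (2 ^ l))"
  obtains D where "0 \<le> D" "\<And>n u v. \<lbrakk>0 \<le> u; u \<le> real N; 0 \<le> v; v \<le> real N; \<bar>u - v\<bar> \<le> R / 2 ^ n\<rbrakk> \<Longrightarrow>
      \<bar>b u - b v\<bar> \<le> D * (sqrt (real n + 1) / sqrt (2 ^ n))"
proof -
  obtain D where D: "0 \<le> D" "\<And>n u. \<lbrakk>0 \<le> u; u \<le> real N\<rbrakk> \<Longrightarrow>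
      \<bar>b u - b (real (nat \<lfloor>u * 2 ^ n\<rfloor>) / 2 ^ n)\<bar> \<le> D * (sqrt (real n + 1) / sqrt (2 ^ n))"
    using dyadic_chaining[OF b C inc] by auto
  have main: "\<bar>b u - b v\<bar> \<le> (2 * D + (R + 1) * C) * (sqrt (real n + 1) / sqrt (2 ^ n))"
    if u: "0 \<le> u" and uv: "u \<le> v" and v: "v \<le> real N" and d: "v - u \<le> R / 2 ^ n" for n u v
  proof -
    let ?w = "sqrt (real n + 1) / sqrt (2 ^ n)"
    define i where "i = nat \<lfloor>u * 2 ^ n\<rfloor>"
    define j where "j = nat \<lfloor>v * 2 ^ n\<rfloor>"
    have ij: "i \<le> j" unfolding i_def j_def using uv by (intro nat_mono floor_mono) simp
    have jv: "real j \<le> v * 2 ^ n" using u uv by (simp add: j_def of_nat_nat)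
    have "u * 2 ^ n < real i + 1" using u by (simp add: i_def of_nat_nat)
    moreover have "v * 2 ^ n - u * 2 ^ n \<le> R" using d by (simp add: field_simps)
    ultimately have jR: "real j - real i \<le> R + 1" using jv by linarith
    have "v * 2 ^ n \<le> real N * 2 ^ n" using v by simp
    then have "real j \<le> real N * 2 ^ n" using jv by linarith
    then have jN: "j \<le> N * 2 ^ n" by (rule nat_le_of_real_le_power)
    have "\<bar>b (real (i + k) / 2 ^ n) - b (real i / 2 ^ n)\<bar> \<le> real k * (C * ?w)" if "i + k \<le> j" for k
      using that
    proof (induction k)
      case (Suc k)
      have "\<bar>b (real (Suc (i + k)) / 2 ^ n) - b (real (i + k) / 2 ^ n)\<bar> \<le> C * ?w"
        using Suc.prems jN by (intro inc) simp
      moreover have "\<bar>b (real (i + k) / 2 ^ n) - b (real i / 2 ^ n)\<bar> \<le> real k * (C * ?w)"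
        using Suc by simp
      moreover have "real (Suc k) * (C * ?w) = real k * (C * ?w) + C * ?w"
        unfolding of_nat_Suc by (simp only: distrib_right mult_1)
      ultimately show ?case unfolding add_Suc_right by linarith
    qed simp
    from this[of "j - i"] ij have "\<bar>b (real j / 2 ^ n) - b (real i / 2 ^ n)\<bar> \<le> (real j - real i) * (C * ?w)"
      by (simp add: of_nat_diff)
    also have "\<dots> \<le> (R + 1) * (C * ?w)" using jR C by (intro mult_right_mono) auto
    finally have "\<bar>b (real j / 2 ^ n) - b (real i / 2 ^ n)\<bar> \<le> (R + 1) * (C * ?w)" .
    moreover have "\<bar>b u - b (real i / 2 ^ n)\<bar> \<le> D * ?w" unfolding i_def using u uv v by (intro D(2)) auto
    moreover have "\<bar>b v - b (real j / 2 ^ n)\<bar> \<le> D * ?w" unfolding j_def using u uv v by (intro D(2)) auto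
    moreover have "(2 * D + (R + 1) * C) * ?w = D * ?w + D * ?w + (R + 1) * (C * ?w)"
      by (simp only: distrib_right mult.assoc mult_2)
    ultimately show ?thesis by linarith
  qed
  show ?thesis
  proof (rule that[of "2 * D + (R + 1) * C"])
    fix n u v assume *: "0 \<le> u" "u \<le> real N" "0 \<le> v" "v \<le> real N" "\<bar>u - v\<bar> \<le> R / 2 ^ n"
    show "\<bar>b u - b v\<bar> \<le> (2 * D + (R + 1) * C) * (sqrt (real n + 1) / sqrt (2 ^ n))"
    proof (cases "u \<le> v")
      case True then show ?thesis using main[of u v n] * by simp
    next
      case False then show ?thesis using main[of v u n] * by (simp add: abs_minus_commute)
    qed
  qed (use C D R in simp)
qed

text \<open>The exponents of the rate arise here. With n the largest level such that 2^n is at most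
  2^m / sqrt m, 2^(-n) is comparable to sqrt m 2^(-m), and the modulus sqrt ((n + 1) 2^(-n)) is at
  most of order sqrt (m sqrt m 2^(-m)).\<close>

lemma modulus_at_walk_scale:
  fixes b :: "real \<Rightarrow> real"
  assumes D: "0 \<le> D" and mod: "\<And>n. \<bar>u - v\<bar> \<le> R / 2 ^ n \<Longrightarrow> \<bar>b u - b v\<bar> \<le> D * (sqrt (real n + 1) / sqrt (2 ^ n))"
    and m: "1 \<le> m" and R: "0 \<le> R" and uv: "\<bar>u - v\<bar> \<le> R * (sqrt (real m) / 2 ^ m)"
  shows "\<bar>b u - b v\<bar> \<le> 2 * D * (real m powr (3/4) * 2 powr (- (real m / 2)))"
proof -
  have r: "1 \<le> sqrt (real m)" using m by simp
  \<comment> \<open>The cap at \<open>m\<close> makes the set finite and later yields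
    \<open>real n + 1 \<le> 2 * real m\<close>; level 0 belongs to the set since
    \<open>sqrt (real m) \<le> 2 ^ m\<close>.\<close>
  define n where "n = Max {n. n \<le> m \<and> sqrt (real m) * 2 ^ n \<le> 2 ^ m}"
  have fin: "finite {n. n \<le> m \<and> sqrt (real m) * 2 ^ n \<le> 2 ^ m}"
    by (rule finite_subset[of _ "{..m}"]) auto
  have "sqrt (real m) \<le> 2 ^ m"
  proof -
    have "sqrt (real m) \<le> real m" using m by (intro real_le_lsqrt) (auto simp: power2_eq_square)
    also have "real m \<le> 2 ^ m" by (simp add: less_imp_le)
    finally show ?thesis .
  qed
  then have "n \<in> {n. n \<le> m \<and> sqrt (real m) * 2 ^ n \<le> 2 ^ m}"
    unfolding n_def by (intro Max_in[OF fin]) auto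
  then have n: "n \<le> m" "sqrt (real m) * 2 ^ n \<le> 2 ^ m" by auto
  have n': "2 ^ m \<le> sqrt (real m) * 2 ^ Suc n"
  proof (cases "n = m")
    case True
    have "(1::real) * 2 ^ m \<le> sqrt (real m) * 2 ^ Suc m" using r by (intro mult_mono) auto
    then show ?thesis using True by simp
  next
    case False
    then have "\<not> sqrt (real m) * 2 ^ Suc n \<le> 2 ^ m"
      using Max_ge[OF fin, of "Suc n"] n(1) by (fold n_def) force
    then show ?thesis by simp
  qed
  have "sqrt (real m) / 2 ^ m \<le> 1 / 2 ^ n" using n(2) by (simp add: field_simps)
  then have "R * (sqrt (real m) / 2 ^ m) \<le> R * (1 / 2 ^ n)" using R by (rule mult_left_mono)
  then have "\<bar>b u - b v\<bar> \<le> D * (sqrt (real n + 1) / sqrt (2 ^ n))"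
    using uv by (intro mod) simp
  moreover have "sqrt (real n + 1) / sqrt (2 ^ n) \<le> 2 * (real m powr (3/4) * 2 powr (- (real m / 2)))"
  proof -
    have "(real n + 1) / 2 ^ n \<le> (2 * real m) * (2 * sqrt (real m) / 2 ^ m)"
    proof -
      have "1 / 2 ^ n \<le> 2 * sqrt (real m) / 2 ^ m" using n' by (simp add: field_simps)
      moreover have "real n + 1 \<le> 2 * real m" using n(1) m by simp
      ultimately have "(real n + 1) * (1 / 2 ^ n) \<le> (2 * real m) * (2 * sqrt (real m) / 2 ^ m)"
        by (intro mult_mono) auto
      then show ?thesis by simp
    qed
    also have "\<dots> = (2 * (real m powr (3/4) * 2 powr (- (real m / 2))))\<^sup>2"
    proof -
      have "(real m powr (3/4))\<^sup>2 = real m powr (1 + 1/2)"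
        using m by (simp add: power2_eq_square powr_add[symmetric])
      also have "\<dots> = real m * sqrt (real m)" using m by (simp only: powr_add powr_half_sqrt) simp
      finally have "(real m powr (3/4))\<^sup>2 = real m * sqrt (real m)" .
      moreover have "(2 powr (- (real m / 2)))\<^sup>2 = 1 / (2::real) ^ m"
        by (simp add: power2_eq_square powr_add[symmetric] powr_minus powr_realpow field_simps)
      ultimately show ?thesis by (simp add: power_mult_distrib)
    qed
    finally have "sqrt ((real n + 1) / 2 ^ n) \<le> 2 * (real m powr (3/4) * 2 powr (- (real m / 2)))"
      by (intro real_le_lsqrt) auto
    then show ?thesis by (simp add: real_sqrt_divide)
  qed
  then have "D * (sqrt (real n + 1) / sqrt (2 ^ n)) \<le> D * (2 * (real m powr (3/4) * 2 powr (- (real m / 2))))"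
    using D by (rule mult_left_mono)
  ultimately show ?thesis by (simp add: mult_ac)
qed

lemma C12_on_locally_Lipschitz:
  assumes "C12_on T \<phi>"
  obtains L where "0 \<le> L" "\<And>t u v. \<lbrakk>t \<in> {0..T}; \<bar>u\<bar> \<le> R; \<bar>v\<bar> \<le> R\<rbrakk> \<Longrightarrow>
      \<bar>\<phi> t u - \<phi> t v\<bar> \<le> L * \<bar>u - v\<bar>"
proof -
  have diff: "\<And>t u. t \<in> {0..T} \<Longrightarrow> (\<phi> t has_field_derivative du \<phi> t u) (at u)"
    using assms by (auto simp: C12_on_def du_def DERIV_deriv_iff_real_differentiable)
  have "continuous_on ({0..T} \<times> UNIV) (\<lambda>(t, u). du \<phi> t u)" using assms by (simp add: C12_on_def)
  then have "compact ((\<lambda>(t, u). du \<phi> t u) ` ({0..T} \<times> {- R..R}))"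
    by (intro compact_continuous_image compact_Times) (auto intro: continuous_on_subset)
  then obtain L where L: "\<forall>x\<in>(\<lambda>(t, u). du \<phi> t u) ` ({0..T} \<times> {- R..R}). \<bar>x\<bar> \<le> L"
    using compact_imp_bounded bounded_real by blast
  show ?thesis
  \<comment> \<open>The absolute value is taken because \<open>L\<close> may be negative when the
    rectangle is empty.\<close>
  proof (rule that[of "\<bar>L\<bar>"])
    fix t u v assume t: "t \<in> {0..T}" and uv: "\<bar>u\<bar> \<le> R" "\<bar>v\<bar> \<le> R"
    have "norm (\<phi> t u - \<phi> t v) \<le> \<bar>L\<bar> * norm (u - v)"
    proof (rule field_differentiable_bound[of "{- R..R}" "\<phi> t" "du \<phi> t"])
      fix z assume z: "z \<in> {- R..R}"
      show "(\<phi> t has_field_derivative du \<phi> t z) (at z within {- R..R})"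
        using diff[OF t] by (rule has_field_derivative_at_within)
      have "\<bar>du \<phi> t z\<bar> \<le> L" using L t z by force
      then show "norm (du \<phi> t z) \<le> \<bar>L\<bar>" by simp
    qed (use uv in \<open>auto simp: abs_le_iff\<close>)
    then show "\<bar>\<phi> t u - \<phi> t v\<bar> \<le> \<bar>L\<bar> * \<bar>u - v\<bar>" by simp
  qed simp
qed

text \<open>Inverts the counting estimate. At a dyadic time just above k 4^(-m) + h at least k exits
  have occurred, and at one just below k 4^(-m) - h fewer than k; rounding to dyadic times costs
  2^(-m).\<close>

lemma exit_time_close:
  assumes b: "continuous_on {0..} b" and m: "1 \<le> m" and s: "exit_times (1 / 2 ^ m) b s"
    and count: "\<And>j K. \<lbrakk>j \<le> N * 2 ^ m; s K \<le> real (Suc j) / 2 ^ m; real (Suc j) / 2 ^ m < s (Suc K)\<rbrakk> \<Longrightarrow>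
        \<bar>real K * (1 / 2 ^ m)\<^sup>2 - real (Suc j) / 2 ^ m\<bar> \<le> h"
    and h: "0 \<le> h" and kN: "real k * (1 / 2 ^ m)\<^sup>2 + h \<le> real N"
  shows "\<bar>s k - real k * (1 / 2 ^ m)\<^sup>2\<bar> \<le> h + 1 / 2 ^ m"
proof -
  define a :: real where "a = 1 / 2 ^ m"
  have a: "0 < a" by (simp add: a_def)
  have mono: "s i \<le> s j" if "i \<le> j" for i j
    using exit_times_mono(1)[OF s] that by (simp add: strict_mono_less_eq)
  have bracket: "\<exists>K. s K \<le> real (Suc j) / 2 ^ m \<and> real (Suc j) / 2 ^ m < s (Suc K)
        \<and> \<bar>real K * a\<^sup>2 - real (Suc j) / 2 ^ m\<bar> \<le> h" if "real j \<le> real N * 2 ^ m" for j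
  proof -
    have "j \<le> N * 2 ^ m" using that by (rule nat_le_of_real_le_power)
    moreover obtain K where "s K \<le> real (Suc j) / 2 ^ m" "real (Suc j) / 2 ^ m < s (Suc K)"
      using exit_times_bracket[OF b _ s, of "real (Suc j) / 2 ^ m"] by auto
    ultimately show ?thesis using count unfolding a_def by blast
  qed
  have "s k \<le> real k * a\<^sup>2 + h + a"
  proof -
    define y where "y = real k * a\<^sup>2 + h"
    have y: "0 \<le> y" "y \<le> real N" using h kN by (auto simp: y_def a_def)
    define j where "j = nat \<lfloor>y * 2 ^ m\<rfloor>"
    have j: "real j \<le> y * 2 ^ m" "y * 2 ^ m < real j + 1" using y by (auto simp: j_def of_nat_nat)
    have "y * 2 ^ m \<le> real N * 2 ^ m" using y by simp
    then have "real j \<le> real N * 2 ^ m" using j by linarith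
    then obtain K where K: "s K \<le> real (Suc j) / 2 ^ m" "\<bar>real K * a\<^sup>2 - real (Suc j) / 2 ^ m\<bar> \<le> h"
      using bracket[of j] by auto
    have "y < real (Suc j) / 2 ^ m" "real (Suc j) / 2 ^ m \<le> y + a"
      using j by (auto simp: a_def field_simps)
    moreover from this have "real k * a\<^sup>2 < real K * a\<^sup>2" using K(2) unfolding y_def by linarith
    then have "s k \<le> s K" using a by (intro mono) simp
    ultimately show ?thesis using K(1) by (simp add: y_def)
  qed
  moreover have "real k * a\<^sup>2 - h - a \<le> s k"
  proof (cases "real k * a\<^sup>2 - h \<le> a")
    case True
    then show ?thesis using exit_times_mono(2)[OF s, of k] by simp
  next
    case False
    define y where "y = real k * a\<^sup>2 - h"
    have y: "a < y" "y \<le> real N" using False h kN by (auto simp: y_def a_def)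
    have "1 < y * 2 ^ m" using y by (simp add: a_def field_simps)
    then have c: "2 \<le> \<lceil>y * 2 ^ m\<rceil>" by linarith
    \<comment> \<open>\<open>Suc j\<close> is the largest integer strictly below
      \<open>y * 2 ^ m\<close>; strictness yields fewer than k exits by that time. As the ceiling is
      at least 2, \<open>nat\<close> truncates nothing.\<close>
    define j where "j = nat (\<lceil>y * 2 ^ m\<rceil> - 2)"
    have j: "real (Suc j) < y * 2 ^ m" "y * 2 ^ m \<le> real (Suc j) + 1"
      using c unfolding j_def by (simp_all add: of_nat_nat) linarith+
    have "y * 2 ^ m \<le> real N * 2 ^ m" using y by simp
    then have "real j \<le> real N * 2 ^ m" using j by linarith
    then obtain K where K: "real (Suc j) / 2 ^ m < s (Suc K)" "\<bar>real K * a\<^sup>2 - real (Suc j) / 2 ^ m\<bar> \<le> h"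
      using bracket[of j] by auto
    have "real (Suc j) / 2 ^ m < y" using j(1) by (subst pos_divide_less_eq) auto
    moreover have "y \<le> (real (Suc j) + 1) / 2 ^ m" using j(2) by (subst pos_le_divide_eq) auto
    then have "y - a \<le> real (Suc j) / 2 ^ m" by (simp add: a_def add_divide_distrib)
    moreover from calculation have "real K * a\<^sup>2 < real k * a\<^sup>2" using K(2) unfolding y_def by linarith
    then have "s (Suc K) \<le> s k" using a by (intro mono) simp
    ultimately show ?thesis using K(1) by (simp add: y_def)
  qed
  ultimately show ?thesis by (simp add: a_def abs_le_iff)
qed

section \<open>Almost sure rate for the embedded walks\<close>

context brownian_motion
begin

theorem AE_skorohod_walk_approximates:
  assumes T: "0 < T"
  shows "AE \<omega> in M. \<exists>C\<ge>0. \<forall>\<^sub>F m in sequentially. \<forall>t\<in>{0..T}.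
    \<bar>skorohod_walk B m t \<omega> - B t \<omega>\<bar> \<le> C * (real m powr (3/4) * 2 powr (- (real m / 2)))"
proof -
  \<comment> \<open>The margin 2 leaves room for a neighbouring grid time, at most T + 1, plus the
    counting error, eventually at most 1.\<close>
  obtain N :: nat where N: "T + 2 \<le> real N" using real_arch_simple by blast
  show ?thesis
    using start_BM continuous_BM AE_BM_unbounded AE_exit_count[of N] AE_dyadic_increments[of N]
  proof eventually_elim
    case (elim \<omega>)
    let ?b = "\<lambda>u. B u \<omega>"
    let ?s = "\<lambda>m k. skorohod_time B m k \<omega>"
    obtain C where C: "0 \<le> C" and count: "\<And>m j K. \<lbrakk>1 \<le> m; j \<le> N * 2 ^ m; ?s m K \<le> real (Suc j) / 2 ^ m;
        real (Suc j) / 2 ^ m < ?s m (Suc K)\<rbrakk> \<Longrightarrow>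
        \<bar>real K * (1 / 2 ^ m)\<^sup>2 - real (Suc j) / 2 ^ m\<bar> \<le> C * (sqrt (real m) / 2 ^ m)"
      using elim(4) by blast
    \<comment> \<open>\<open>C\<close> comes from the counting estimate; one unit is for the dyadic
      rounding in \<open>exit_time_close\<close>, the other for the distance from \<open>t\<close>
      to the grid of the walk.\<close>
    define R where "R = C + 2"
    have R: "0 \<le> R" using C by (simp add: R_def)
    obtain C1 where C1: "0 \<le> C1" "\<And>l j. j \<le> N * 2 ^ l \<Longrightarrow>
        \<bar>?b (real (Suc j) / 2 ^ l) - ?b (real j / 2 ^ l)\<bar> \<le> C1 * (sqrt (real l + 1) / sqrt (2 ^ l))"
      using elim(5) by blast
    obtain D where D: "0 \<le> D"
        "\<And>n u v. \<lbrakk>0 \<le> u; u \<le> real N; 0 \<le> v; v \<le> real N; \<bar>u - v\<bar> \<le> R / 2 ^ n\<rbrakk> \<Longrightarrow>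
          \<bar>?b u - ?b v\<bar> \<le> D * (sqrt (real n + 1) / sqrt (2 ^ n))"
      using dyadic_modulus_of_continuity[OF elim(2) C1(1) R C1(2)] by auto
    have "(\<lambda>m. R * (sqrt (real m) / 2 ^ m)) \<longlonglongrightarrow> 0" by real_asymp
    then have "\<forall>\<^sub>F m in sequentially. R * (sqrt (real m) / 2 ^ m) < 1"
      by (rule order_tendstoD) simp
    then have "\<forall>\<^sub>F m in sequentially. \<forall>t\<in>{0..T}.
      \<bar>skorohod_walk B m t \<omega> - B t \<omega>\<bar> \<le> 2 * D * (real m powr (3/4) * 2 powr (- (real m / 2)))"
      using eventually_ge_at_top[of 1]
    proof eventually_elim
      case (elim m)
      define r where "r = sqrt (real m) / 2 ^ m"
      define a :: real where "a = 1 / 2 ^ m"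
      have small: "R * r < 1" using elim by (simp add: r_def)
      have a: "0 < a" "a \<le> 1" "a \<le> r" using elim(2) by (auto simp: a_def r_def divide_right_mono)
      have a2: "a\<^sup>2 \<le> r" using a by (simp add: power2_eq_square mult_le_one order_trans[OF mult_left_le_one_le])
      have ex: "exit_times a ?b (?s m)"
        unfolding a_def using \<open>continuous_on _ _\<close> \<open>\<forall>R. \<exists>n. _ R n\<close> by (intro exit_times_skorohod_time) auto
      have Cr: "0 \<le> C * r" "C * r \<le> 1" using small C a by (auto simp: R_def algebra_simps)
      have near: "\<bar>?b (?s m k) - ?b t\<bar> \<le> 2 * D * (real m powr (3/4) * 2 powr (- (real m / 2)))"
        if t: "0 \<le> t" "t \<le> T" and k: "\<bar>real k * a\<^sup>2 - t\<bar> \<le> a\<^sup>2" for t k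
      proof -
        have "a\<^sup>2 \<le> 1" using a by (simp add: power_le_one)
        then have "real k * a\<^sup>2 + C * r \<le> real N" using N t k Cr by linarith
        then have "\<bar>?s m k - real k * (1 / 2 ^ m)\<^sup>2\<bar> \<le> C * r + 1 / 2 ^ m"
          using exit_time_close[OF \<open>continuous_on _ _\<close> elim(2) ex[unfolded a_def], of N "C * r" k]
             count[OF elim(2)] Cr by (auto simp: r_def a_def)
        then have "\<bar>?s m k - t\<bar> \<le> R * r" using k a a2 by (simp add: R_def a_def algebra_simps)
        moreover from this have "?s m k \<le> real N" using small N t by linarith
        ultimately show ?thesis
          using exit_times_mono(2)[OF ex, of k] N t
          by (intro modulus_at_walk_scale[where b = "?b", OF D(1) _ elim(2) R] D(2)) (auto simp: r_def)
      qed
      show ?case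
      proof
        fix t assume "t \<in> {0..T}"
        then have t: "0 \<le> t" "t \<le> T" by auto
        let ?Q = "2 * D * (real m powr (3/4) * 2 powr (- (real m / 2)))"
        define k where "k = nat \<lfloor>t * 2 ^ (2 * m)\<rfloor>"
        define \<theta> where "\<theta> = frac (t * 2 ^ (2 * m))"
        have \<theta>: "0 \<le> \<theta>" "\<theta> \<le> 1" by (auto simp: \<theta>_def frac_lt_1 less_imp_le)
        have k: "real k \<le> t * 2 ^ (2 * m)" "t * 2 ^ (2 * m) \<le> real k + 1"
          using t by (auto simp: k_def of_nat_nat less_imp_le)
        have a22: "a\<^sup>2 = 1 / 2 ^ (2 * m)" by (simp add: a_def power_divide power_mult mult.commute)
        have "real k * a\<^sup>2 \<le> t" "t \<le> (real k + 1) * a\<^sup>2" using k by (auto simp: a22 field_simps)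
        then have "\<bar>real k * a\<^sup>2 - t\<bar> \<le> a\<^sup>2" "\<bar>real (Suc k) * a\<^sup>2 - t\<bar> \<le> a\<^sup>2"
          by (auto simp: algebra_simps abs_le_iff)
        then have n: "\<bar>?b (?s m k) - ?b t\<bar> \<le> ?Q" "\<bar>?b (?s m (Suc k)) - ?b t\<bar> \<le> ?Q"
          using near[OF t] by blast+
        \<comment> \<open>The walk at \<open>t\<close> is a convex combination of the path at two
          embedding times, both covered by \<open>near\<close>, so interpolation preserves the
          bound.\<close>
        have "skorohod_walk B m t \<omega> - B t \<omega>
            = (1 - \<theta>) * (?b (?s m k) - ?b t) + \<theta> * (?b (?s m (Suc k)) - ?b t)"
          unfolding skorohod_walk_def Let_def k_def[symmetric] \<theta>_def[symmetric]
          by (simp add: algebra_simps del: skorohod_time.simps)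
        also have "\<bar>\<dots>\<bar> \<le> (1 - \<theta>) * \<bar>?b (?s m k) - ?b t\<bar> + \<theta> * \<bar>?b (?s m (Suc k)) - ?b t\<bar>"
          using \<theta> by (intro order_trans[OF abs_triangle_ineq]) (simp add: abs_mult)
        also have "\<dots> \<le> (1 - \<theta>) * ?Q + \<theta> * ?Q"
          using \<theta> n by (intro add_mono mult_left_mono) auto
        also have "\<dots> = ?Q" by (simp add: algebra_simps)
        finally show "\<bar>skorohod_walk B m t \<omega> - B t \<omega>\<bar> \<le> ?Q" .
      qed
    qed
    then show ?case using D(1) by (intro exI[of _ "2 * D"]) simp
  qed
qed

end

section \<open>Transfer from the walk to the solution\<close>

theorem theorem1:
  fixes T x0 :: real
    and \<mu> \<sigma> \<phi> :: "real \<Rightarrow> real \<Rightarrow> real"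
    and D :: "real set"
    and M :: "'a measure"
    and B X \<psi> I \<Lambda> :: "real \<Rightarrow> 'a \<Rightarrow> real"
    and \<nu> :: "real \<Rightarrow> real \<Rightarrow> real"
    and X_approx :: "nat \<Rightarrow> real \<Rightarrow> 'a \<Rightarrow> real"
  assumes T: "0 < T"
    and complete: "complete_measure M"
    and BM: "brownian_motion M B"
    and flow: "unique_flow T x0 \<sigma> \<phi>"
    and D: "D = {\<phi> t u | t u. t \<in> {0..T}}"
    and mu_cont: "continuous_on ({0..T} \<times> D) (\<lambda>(t, x). \<mu> t x)"
    and sigma_cont: "continuous_on ({0..T} \<times> D) (\<lambda>(t, x). \<sigma> t x)"
    and sigma_pos: "\<And>t x. t \<in> {0..T} \<Longrightarrow> x \<in> D \<Longrightarrow> 0 < \<sigma> t x"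
    and phi_C12: "C12_on T \<phi>"
    and X: "\<And>t \<omega>. t \<in> {0..T} \<Longrightarrow> X t \<omega> = \<phi> t (B t \<omega>)"
    and nu: "\<And>t u. t \<in> {0..T} \<Longrightarrow> \<nu> t u = dt T \<phi> t u + 1/2 * du (du \<phi>) t u"
    and psi: "\<And>t \<omega>. t \<in> {0..T} \<Longrightarrow>
                \<psi> t \<omega> = (\<nu> t (B t \<omega>) - \<mu> t (X t \<omega>)) / \<sigma> t (X t \<omega>)"
    and I: "ito_integral M (augmented_filtration M B) B T \<psi> I"
    and Lambda: "\<And>t \<omega>. t \<in> {0..T} \<Longrightarrow>
                \<Lambda> t \<omega> = exp (- I t \<omega> - 1/2 * (LINT s:{0..t}|lborel. (\<psi> s \<omega>)\<^sup>2))"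
    and Lambda_martingale: "martingale_upto M (augmented_filtration M B) T \<Lambda>"
    and X_approx: "\<And>m t \<omega>. t \<in> {0..T} \<Longrightarrow> X_approx m t \<omega> = \<phi> t (skorohod_walk B m t \<omega>)"
  shows "AE \<omega> in M.
           (\<lambda>m. SUP t\<in>{0..T}. \<bar>X_approx m t \<omega> - X t \<omega>\<bar>)
             \<in> O(\<lambda>m. real m powr (3/4) * 2 powr (- (real m / 2)))"
proof -
  interpret brownian_motion M B by (rule BM)
  let ?rate = "\<lambda>m::nat. real m powr (3/4) * 2 powr (- (real m / 2))"
  show ?thesis
    using continuous_BM AE_skorohod_walk_approximates[OF T]
  proof eventually_elim
    case (elim \<omega>)
    obtain C where C: "0 \<le> C" and walk: "\<forall>\<^sub>F m in sequentially. \<forall>t\<in>{0..T}.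
        \<bar>skorohod_walk B m t \<omega> - B t \<omega>\<bar> \<le> C * ?rate m"
      using elim(2) by blast
    have "compact ((\<lambda>t. B t \<omega>) ` {0..T})"
      by (intro compact_continuous_image continuous_on_subset[OF elim(1)]) auto
    then obtain R where "\<forall>x\<in>(\<lambda>t. B t \<omega>) ` {0..T}. \<bar>x\<bar> \<le> R"
      using compact_imp_bounded bounded_real by blast
    then have R: "\<bar>B t \<omega>\<bar> \<le> R" if "t \<in> {0..T}" for t using that by blast
    \<comment> \<open>Radius \<open>R + 1\<close> leaves room for the walk, which is eventually
      within 1 of the path.\<close>
    obtain L where L: "0 \<le> L" "\<And>t u v. \<lbrakk>t \<in> {0..T}; \<bar>u\<bar> \<le> R + 1; \<bar>v\<bar> \<le> R + 1\<rbrakk> \<Longrightarrow>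
        \<bar>\<phi> t u - \<phi> t v\<bar> \<le> L * \<bar>u - v\<bar>"
      using C12_on_locally_Lipschitz[OF phi_C12, of "R + 1"] by blast
    have "(\<lambda>m. C * ?rate m) \<longlonglongrightarrow> 0" by real_asymp
    then have "\<forall>\<^sub>F m in sequentially. C * ?rate m < 1" by (rule order_tendstoD) simp
    with walk have "\<forall>\<^sub>F m in sequentially.
        norm (SUP t\<in>{0..T}. \<bar>X_approx m t \<omega> - X t \<omega>\<bar>) \<le> (L * C) * norm (?rate m)"
    proof eventually_elim
      case (elim m)
      have le: "\<bar>X_approx m t \<omega> - X t \<omega>\<bar> \<le> (L * C) * ?rate m" if t: "t \<in> {0..T}" for t
      proof -
        have w: "\<bar>skorohod_walk B m t \<omega> - B t \<omega>\<bar> \<le> C * ?rate m" using elim(1) t by blast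
        then have "\<bar>skorohod_walk B m t \<omega>\<bar> \<le> R + 1" using elim(2) R[OF t] by linarith
        then have "\<bar>X_approx m t \<omega> - X t \<omega>\<bar> \<le> L * \<bar>skorohod_walk B m t \<omega> - B t \<omega>\<bar>"
          unfolding X[OF t] X_approx[OF t] using R[OF t] by (intro L(2) t) auto
        also have "\<dots> \<le> L * (C * ?rate m)" using w L(1) by (rule mult_left_mono)
        finally show ?thesis by (simp add: mult.assoc)
      qed
      then have bdd: "bdd_above ((\<lambda>t. \<bar>X_approx m t \<omega> - X t \<omega>\<bar>) ` {0..T})"
        by (intro bdd_aboveI2)
      \<comment> \<open>Evaluation at time 0 shows that the supremum is nonnegative, so it equals
        its norm.\<close>
      have "\<bar>X_approx m 0 \<omega> - X 0 \<omega>\<bar> \<le> (SUP t\<in>{0..T}. \<bar>X_approx m t \<omega> - X t \<omega>\<bar>)"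
        using T by (intro cSUP_upper bdd) auto
      then have "0 \<le> (SUP t\<in>{0..T}. \<bar>X_approx m t \<omega> - X t \<omega>\<bar>)" by linarith
      moreover have "(SUP t\<in>{0..T}. \<bar>X_approx m t \<omega> - X t \<omega>\<bar>) \<le> (L * C) * ?rate m"
        using T le by (intro cSUP_least) auto
      ultimately show ?case by simp
    qed
    then show ?case by (rule bigoI)
  qed
qed

end
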